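(* Let $G$ be a countable group and let $S$ be a subset of $G$. Let $G\curvearrowright X$ be a free Borel action of $G$ on a standard Borel space $X$. Then $\chi_B(\mathcal{G}_{X})\leq \chi_B (\mathcal{G}_{\mathrm{Free}(2^G)})$.
   Context: $G$ acts on $2^G=\{0,1\}^G$ (product topology) by $(g\cdot w)(h)=w(g^{-1}h)$, and $\mathrm{Free}(2^G)=\{w\in 2^G : \forall g\in G\ (g\neq 1_G\Rightarrow g\cdot w\neq w)\}$, on which $G$ acts freely. A graph on a set $X$ is a symmetric irreflexive subset $\mathcal{G}\subseteq X\times X$; it is a Borel graph if $X$ is a standard Borel space and $\mathcal{G}$ is Borel in $X\times X$. A $K$-coloring of $\mathcal{G}$ is a map $\kappa:X\to K$ with $\kappa(x)\neq\kappa(y)$ whenever $(x,y)\in\mathcal{G}$. The Borel chromatic number $\chi_B(\mathcal{G})$ is the minimum cardinality of a standard Borel space $K$ for which there exists a Borel $K$-coloring $\kappa:X\to K$ of $\mathcal{G}$. With $S\subseteq G$ fixed, to each free Borel action $G\curvearrowright X$ is associated the Borel graph $\mathcal{G}_X=\{(x,s\cdot x) : x\in X,\ s\in S\cup S^{-1},\ s\neq 1_G\}$. *)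

theory Defs
  imports "HOL-Analysis.Analysis" "HOL-Algebra.Group_Action"
begin

unbundle cardinal_syntax

subsection \<open>Standard Borel spaces\<close>

definition borel_of :: "'a topology \<Rightarrow> 'a measure" where
  "borel_of T = sigma (topspace T) {U. openin T U}"

definition polish_topology :: "'a topology \<Rightarrow> bool" where
  "polish_topology T \<longleftrightarrow> completely_metrizable_space T \<and> separable_space T"

text \<open>Only \<^term>\<open>space M\<close> and \<^term>\<open>sets M\<close> matter; the measure component is ignored throughout.\<close>

definition standard_borel :: "'a measure \<Rightarrow> bool" where
  "standard_borel M \<longleftrightarrow>
     (\<exists>T. polish_topology T \<and> space M = topspace T \<and> sets M = sets (borel_of T))"

subsection \<open>Borel colorings and the Borel chromatic number\<close>

definition borel_coloring ::
  "'x measure \<Rightarrow> ('x \<times> 'x) set \<Rightarrow> 'k measure \<Rightarrow> ('x \<Rightarrow> 'k) \<Rightarrow> bool" where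
  "borel_coloring M E K \<kappa> \<longleftrightarrow>
     \<kappa> \<in> measurable M K \<and> (\<forall>(x, y)\<in>E. \<kappa> x \<noteq> \<kappa> y)"

definition borel_colorable :: "'x measure \<Rightarrow> ('x \<times> 'x) set \<Rightarrow> 'k measure \<Rightarrow> bool" where
  "borel_colorable M E K \<longleftrightarrow> standard_borel K \<and> (\<exists>\<kappa>. borel_coloring M E K \<kappa>)"

text \<open>
  The Borel chromatic number is a cardinal (a cardinal order on a set of reals, compared by
  \<open>\<le>o\<close>). The color spaces range over all standard Borel structures carried by sets of reals; these
  are arbitrary structures, not only those induced from the usual topology of the reals. Since
  a standard Borel space has at most continuum many points, each one has an isomorphic copy of this
  kind. The lemmas \<open>borel_chromatic_number_le\<close> and \<open>borel_chromatic_number_attained\<close> below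
  confirm that this yields the minimum over standard Borel spaces of every type.
\<close>

definition borel_chromatic_number :: "'x measure \<Rightarrow> ('x \<times> 'x) set \<Rightarrow> real rel" where
  "borel_chromatic_number M E =
     (SOME r. (\<exists>K::real measure. borel_colorable M E K \<and> r = |space K| ) \<and>
              (\<forall>K::real measure. borel_colorable M E K \<longrightarrow> r \<le>o |space K| ))"

subsection \<open>Actions and their graphs\<close>

text \<open>The group carries the discrete Borel structure.\<close>

definition borel_action ::
  "('g, 'm) monoid_scheme \<Rightarrow> 'x measure \<Rightarrow> ('g \<Rightarrow> 'x \<Rightarrow> 'x) \<Rightarrow> bool" where
  "borel_action G X a \<longleftrightarrow>
     group_action G (space X) a \<and>
     (\<lambda>(g, x). a g x) \<in> measurable (count_space (carrier G) \<Otimes>\<^sub>M X) X"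

definition free_action ::
  "('g, 'm) monoid_scheme \<Rightarrow> 'x set \<Rightarrow> ('g \<Rightarrow> 'x \<Rightarrow> 'x) \<Rightarrow> bool" where
  "free_action G X a \<longleftrightarrow> (\<forall>g\<in>carrier G. \<forall>x\<in>X. g \<noteq> \<one>\<^bsub>G\<^esub> \<longrightarrow> a g x \<noteq> x)"

definition action_graph ::
  "('g, 'm) monoid_scheme \<Rightarrow> 'g set \<Rightarrow> 'x set \<Rightarrow> ('g \<Rightarrow> 'x \<Rightarrow> 'x) \<Rightarrow> ('x \<times> 'x) set" where
  "action_graph G S X a =
     {(x, a s x) | x s. x \<in> X \<and> s \<in> S \<union> (\<lambda>s. inv\<^bsub>G\<^esub> s) ` S \<and> s \<noteq> \<one>\<^bsub>G\<^esub>}"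

subsection \<open>The free part of the shift\<close>

text \<open>Points of \<open>2\<^sup>G\<close> are extensional functions from \<^term>\<open>carrier G\<close> to \<^typ>\<open>bool\<close>.\<close>

definition shift_topology :: "('g, 'm) monoid_scheme \<Rightarrow> ('g \<Rightarrow> bool) topology" where
  "shift_topology G = product_topology (\<lambda>_. discrete_topology UNIV) (carrier G)"

definition shift :: "('g, 'm) monoid_scheme \<Rightarrow> 'g \<Rightarrow> ('g \<Rightarrow> bool) \<Rightarrow> 'g \<Rightarrow> bool" where
  "shift G g w = (\<lambda>h\<in>carrier G. w (inv\<^bsub>G\<^esub> g \<otimes>\<^bsub>G\<^esub> h))"

definition free_part :: "('g, 'm) monoid_scheme \<Rightarrow> ('g \<Rightarrow> bool) set" where
  "free_part G = {w \<in> topspace (shift_topology G).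
     \<forall>g\<in>carrier G. g \<noteq> \<one>\<^bsub>G\<^esub> \<longrightarrow> shift G g w \<noteq> w}"

definition free_shift :: "('g, 'm) monoid_scheme \<Rightarrow> ('g \<Rightarrow> bool) measure" where
  "free_shift G = restrict_space (borel_of (shift_topology G)) (free_part G)"

subsection \<open>Adequacy of the Borel chromatic number\<close>

lemma space_borel_of [simp]: "space (borel_of T) = topspace T"
  by (simp add: borel_of_def space_measure_of_conv)

lemma sets_borel_of: "sets (borel_of T) = sigma_sets (topspace T) {U. openin T U}"
  unfolding borel_of_def by (rule sets_measure_of) (auto dest: openin_subset)

lemma continuous_map_borel_of:
  assumes "continuous_map T T' f"
  shows "f \<in> measurable (borel_of T) (borel_of T')"
  unfolding borel_of_def[of T']
proof (rule measurable_measure_of)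
  show "{U. openin T' U} \<subseteq> Pow (topspace T')"
    by (auto dest: openin_subset)
  show "f \<in> space (borel_of T) \<rightarrow> topspace T'"
    using assms by (auto simp: continuous_map_def)
  fix U assume "U \<in> {U. openin T' U}"
  then have "openin T {x \<in> topspace T. f x \<in> U}"
    using assms by (auto simp: continuous_map_def)
  moreover have "f -` U \<inter> space (borel_of T) = {x \<in> topspace T. f x \<in> U}"
    by auto
  ultimately show "f -` U \<inter> space (borel_of T) \<in> sets (borel_of T)"
    by (simp add: sets_borel_of sigma_sets.Basic)
qed

lemma polish_topology_lepoll_reals:
  assumes "polish_topology T"
  shows "topspace T \<lesssim> (UNIV :: real set)"
proof -
  obtain M d where Md: "Metric_space M d" and T: "T = Metric_space.mtopology M d"
    using assms by (auto simp: polish_topology_def completely_metrizable_space_def)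
  interpret Metric_space M d by (fact Md)
  obtain C where C: "countable C" "C \<subseteq> M" "mtopology closure_of C = M"
    using assms by (auto simp: polish_topology_def separable_space_def T)
  define P where "P = C \<times> (\<rat> :: real set)"
  have cP: "countable P"
    unfolding P_def using C(1) countable_rat by blast
  define F where "F x = to_nat_on P ` {(c, q) \<in> P. d c x < q}" for x
  have "inj_on F M"
  proof (rule inj_onI, rule ccontr)
    fix x y assume x: "x \<in> M" and y: "y \<in> M" and eq: "F x = F y" and "x \<noteq> y"
    then have "d x y / 2 > 0" by simp
    moreover have "x \<in> mtopology closure_of C" using x C by simp
    ultimately obtain c where c: "c \<in> C" "d x c < d x y / 2"
      unfolding metric_closure_of mem_Collect_eq in_mball by blast
    obtain q :: real where q: "q \<in> \<rat>" "d x c < q" "q < d x y / 2"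
      using Rats_dense_in_real[OF c(2)] by auto
    have "inj_on (to_nat_on P) P" by (rule inj_on_to_nat_on[OF cP])
    then have "{(c, q) \<in> P. d c x < q} = {(c, q) \<in> P. d c y < q}"
      using eq inj_on_image_eq_iff[of "to_nat_on P" P] unfolding F_def by blast
    moreover have "(c, q) \<in> {(c, q) \<in> P. d c x < q}"
      using c q commute[of c x] by (auto simp: P_def)
    ultimately have "d c y < q" by auto
    then have "d x y < d x y"
      using triangle[of x c y] x y c(1) C(2) q by auto
    then show False by simp
  qed
  then have "M \<lesssim> (UNIV :: nat set set)"
    by (auto simp: lepoll_def)
  also have "\<dots> \<approx> (UNIV :: real set)"
    by (rule nat_sets_eqpoll_reals)
  finally show ?thesis by (simp add: T)
qed

lemma standard_borel_copy:
  fixes K :: "'k measure"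
  assumes "standard_borel K"
  obtains K' :: "real measure" and f
  where "standard_borel K'" "f \<in> measurable K K'" "bij_betw f (space K) (space K')"
proof -
  obtain T where T: "polish_topology T" "space K = topspace T" "sets K = sets (borel_of T)"
    using assms by (auto simp: standard_borel_def)
  obtain f :: "'k \<Rightarrow> real" where f: "inj_on f (topspace T)"
    using polish_topology_lepoll_reals[OF T(1)] by (auto simp: lepoll_def)
  define A where "A = f ` topspace T"
  define g where "g = inv_into (topspace T) f"
  define T' where "T' = pullback_topology A g T"
  have gf: "g (f x) = x" if "x \<in> topspace T" for x
    using that f by (simp add: g_def)
  have ts: "topspace T' = A"
    by (auto simp: T'_def topspace_pullback_topology A_def gf)
  have "continuous_map T T' f"
    unfolding continuous_map_def
  proof (intro conjI allI impI)
    show "f \<in> topspace T \<rightarrow> topspace T'" by (auto simp: ts A_def)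
    fix V assume "openin T' V"
    then obtain U where U: "openin T U" "V = g -` U \<inter> A"
      by (auto simp: T'_def openin_pullback_topology)
    have "{x \<in> topspace T. f x \<in> V} = U"
      using openin_subset[OF U(1)] by (auto simp: U(2) A_def gf dest: inj_onD[OF f])
    then show "openin T {x \<in> topspace T. f x \<in> V}" using U by simp
  qed
  moreover have "continuous_map T' T g"
    unfolding continuous_map_def
  proof (intro conjI allI impI)
    show "g \<in> topspace T' \<rightarrow> topspace T" by (auto simp: ts A_def gf)
    fix U assume U: "openin T U"
    have "{x \<in> topspace T'. g x \<in> U} = g -` U \<inter> A" by (auto simp: ts)
    then show "openin T' {x \<in> topspace T'. g x \<in> U}"
      using U by (auto simp: T'_def openin_pullback_topology)
  qed
  ultimately have "homeomorphic_maps T T' f g"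
    by (auto simp: homeomorphic_maps_def ts gf A_def)
  then have "T homeomorphic_space T'"
    by (auto simp: homeomorphic_space_def)
  then have "polish_topology T'"
    using T(1) homeomorphic_completely_metrizable_space homeomorphic_separable_space
    unfolding polish_topology_def by blast
  then have "standard_borel (borel_of T')"
    by (auto simp: standard_borel_def)
  moreover have "f \<in> measurable K (borel_of T')"
    using continuous_map_borel_of[OF \<open>continuous_map T T' f\<close>]
      measurable_cong_sets[OF T(3) refl] by blast
  moreover have "bij_betw f (space K) (space (borel_of T'))"
    using f by (auto simp: bij_betw_def T(2) ts A_def)
  ultimately show thesis by (rule that)
qed

lemma borel_colorable_copy:
  fixes K :: "'k measure"
  assumes "borel_colorable M E K" "E \<subseteq> space M \<times> space M"
  obtains K' :: "real measure"
  where "borel_colorable M E K'" "|space K'| =o |space K|"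
proof -
  obtain \<kappa> where \<kappa>: "borel_coloring M E K \<kappa>" and K: "standard_borel K"
    using assms by (auto simp: borel_colorable_def)
  obtain K' :: "real measure" and f where K': "standard_borel K'" "f \<in> measurable K K'"
    "bij_betw f (space K) (space K')"
    using standard_borel_copy[OF K] .
  have "f \<circ> \<kappa> \<in> measurable M K'"
    using \<kappa> K'(2) by (auto simp: borel_coloring_def)
  moreover have "f (\<kappa> x) \<noteq> f (\<kappa> y)" if "(x, y) \<in> E" for x y
  proof -
    have "\<kappa> x \<in> space K" "\<kappa> y \<in> space K" "\<kappa> x \<noteq> \<kappa> y"
      using that \<kappa> assms(2) by (auto simp: borel_coloring_def measurable_def)
    then show ?thesis
      using K'(3) by (auto simp: bij_betw_def dest: inj_onD)
  qed
  ultimately have "borel_coloring M E K' (f \<circ> \<kappa>)"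
    by (auto simp: borel_coloring_def)
  with K'(1) have "borel_colorable M E K'" by (auto simp: borel_colorable_def)
  moreover have "|space K'| =o |space K|"
    using K'(3) card_of_ordIso ordIso_symmetric by blast
  ultimately show thesis by (rule that)
qed

lemma borel_chromatic_number_min:
  fixes K :: "'k measure"
  assumes "borel_colorable M E K" "E \<subseteq> space M \<times> space M"
  shows "(\<exists>K'::real measure. borel_colorable M E K' \<and> borel_chromatic_number M E = |space K'| ) \<and>
         (\<forall>K'::real measure. borel_colorable M E K' \<longrightarrow> borel_chromatic_number M E \<le>o |space K'| )"
proof -
  define R where "R = {|space K'| | K'::real measure. borel_colorable M E K'}"
  obtain K' :: "real measure" where "borel_colorable M E K'"
    using borel_colorable_copy[OF assms] .
  then have "R \<noteq> {}" by (auto simp: R_def)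
  moreover have "\<forall>r\<in>R. Card_order r" by (auto simp: R_def card_of_Card_order)
  ultimately obtain r where "r \<in> R" "\<forall>r'\<in>R. r \<le>o r'"
    using exists_minim_Card_order[of R] by blast
  then have "\<exists>r. (\<exists>K'::real measure. borel_colorable M E K' \<and> r = |space K'| ) \<and>
      (\<forall>K'::real measure. borel_colorable M E K' \<longrightarrow> r \<le>o |space K'| )"
    by (auto simp: R_def)
  then show ?thesis
    unfolding borel_chromatic_number_def by (rule someI_ex)
qed

lemma borel_chromatic_number_le:
  fixes K :: "'k measure"
  assumes "borel_colorable M E K" "E \<subseteq> space M \<times> space M"
  shows "borel_chromatic_number M E \<le>o |space K|"
proof -
  obtain K' :: "real measure" where "borel_colorable M E K'" "|space K'| =o |space K|"
    using borel_colorable_copy[OF assms] .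
  then show ?thesis
    using borel_chromatic_number_min[OF assms] ordLeq_ordIso_trans by blast
qed

lemma borel_chromatic_number_attained:
  assumes "standard_borel M" "E \<subseteq> space M \<times> space M" "irrefl E"
  shows "\<exists>K::real measure. borel_colorable M E K \<and> borel_chromatic_number M E = |space K|"
proof -
  have "borel_coloring M E M (\<lambda>x. x)"
    using assms(3) by (auto simp: borel_coloring_def irrefl_def)
  then have "borel_colorable M E M"
    using assms(1) by (auto simp: borel_colorable_def)
  then show ?thesis
    using borel_chromatic_number_min[OF _ assms(2)] by blast
qed

end

theory Submission
  imports Defs "HOL-Real_Asymp.Real_Asymp"
begin

text \<open>
  Colorings pull back along Borel equivariant maps, so it suffices to map \<open>X\<close> equivariantly into
  the free part of the shift. Such a map is \<open>x \<mapsto> (h \<mapsto> h\<^sup>-\<^sup>1 x \<in> A)\<close> for a Borel set \<open>A\<close> with the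
  property that for all \<open>x\<close> and \<open>g \<noteq> 1\<close> some \<open>h\<close> puts exactly one of \<open>h x\<close>, \<open>h g x\<close> into \<open>A\<close>. If
  \<open>G\<close> is finite, a Borel transversal works. If \<open>G\<close> is infinite, \<open>A\<close> is built in stages, one for each
  \<open>g \<noteq> 1\<close>, and the set of still undecided points stays syndetic throughout.

  In one stage, choose a finite window \<open>W\<close> such that every \<open>W x\<close> contains at least \<open>N\<close> undecided
  points, where \<open>|W|\<close> is linear in \<open>N\<close>, and a maximal Borel set \<open>M\<close> of widely separated markers. In
  each window \<open>W m\<close> one point is kept undecided, and everything outside the windows is put outside
  \<open>A\<close>. Translating by markers, it remains to separate \<open>m\<close> from \<open>\<gamma> m\<close> for all markers \<open>m\<close> and all
  \<open>\<gamma>\<close> from a set of conjugates of \<open>g\<close> and its inverse of size at most \<open>2|W|\<^sup>6\<close>. The windows are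
  filled greedily along a countable Borel coloring of the markers; a single \<open>\<gamma>\<close> rules out at most a
  fraction \<open>2^(-(N - 2)/3)\<close> of the patterns in a window, so for large \<open>N\<close> a good pattern exists.
\<close>

section \<open>Counting arguments for labels of a finite window\<close>

text \<open>A union bound: \<open>Bad \<gamma>\<close> injects into the subsets of
  \<open>K - L \<gamma>\<close>, so it has at most \<open>2 ^ (card K - n)\<close> members, and
  fewer than \<open>2 ^ n\<close> such families cannot exhaust \<open>Pow K\<close>.\<close>

lemma avoid_bad_sets:
  assumes "finite K" "finite \<Gamma>" "card \<Gamma> < 2 ^ n"
    and L: "\<And>\<gamma>. \<gamma> \<in> \<Gamma> \<Longrightarrow> L \<gamma> \<subseteq> K \<and> n \<le> card (L \<gamma>)"
    and Bad: "\<And>\<gamma>. \<gamma> \<in> \<Gamma> \<Longrightarrow> Bad \<gamma> \<subseteq> Pow K \<and> inj_on (\<lambda>s. s - L \<gamma>) (Bad \<gamma>)"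
  shows "\<exists>s\<subseteq>K. \<forall>\<gamma>\<in>\<Gamma>. s \<notin> Bad \<gamma>"
proof (cases "\<Gamma> = {}")
  case False
  then obtain \<gamma>0 where "\<gamma>0 \<in> \<Gamma>" by auto
  then have nK: "n \<le> card K"
    using L[of \<gamma>0] card_mono[OF \<open>finite K\<close>] le_trans by blast
  have b: "card (Bad \<gamma>) \<le> 2 ^ (card K - n)" if "\<gamma> \<in> \<Gamma>" for \<gamma>
  proof -
    have "(\<lambda>s. s - L \<gamma>) ` Bad \<gamma> \<subseteq> Pow (K - L \<gamma>)" using Bad[OF that] by auto
    then have "card (Bad \<gamma>) \<le> card (Pow (K - L \<gamma>))"
      using Bad[OF that] assms(1) by (metis card_inj_on_le finite_Diff finite_Pow_iff)
    also have "\<dots> = 2 ^ (card K - card (L \<gamma>))"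
      using L[OF that] assms(1) finite_subset[of "L \<gamma>" K] by (simp add: card_Pow card_Diff_subset)
    also have "\<dots> \<le> 2 ^ (card K - n)" using L[OF that] by (intro power_increasing) auto
    finally show ?thesis .
  qed
  have "card (\<Union>\<gamma>\<in>\<Gamma>. Bad \<gamma>) \<le> (\<Sum>\<gamma>\<in>\<Gamma>. card (Bad \<gamma>))"
    by (rule card_UN_le[OF assms(2)])
  also have "\<dots> \<le> card \<Gamma> * 2 ^ (card K - n)"
    using sum_bounded_above[of \<Gamma> "\<lambda>\<gamma>. card (Bad \<gamma>)"] b by simp
  also have "\<dots> < 2 ^ n * 2 ^ (card K - n)" using assms(3) by simp
  also have "\<dots> = card (Pow K)" using nK assms(1) by (simp add: card_Pow flip: power_add)
  finally have lt: "card (\<Union>\<gamma>\<in>\<Gamma>. Bad \<gamma>) < card (Pow K)" .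
  have "\<not> Pow K \<subseteq> (\<Union>\<gamma>\<in>\<Gamma>. Bad \<gamma>)"
  proof
    assume "Pow K \<subseteq> (\<Union>\<gamma>\<in>\<Gamma>. Bad \<gamma>)"
    moreover have "finite (\<Union>\<gamma>\<in>\<Gamma>. Bad \<gamma>)"
      using assms(1,2) Bad by (meson finite_UN_I finite_Pow_iff finite_subset)
    ultimately show False using lt by (metis card_mono not_le)
  qed
  then show ?thesis by auto
qed auto

text \<open>Fixes the window size: \<open>t\<close> will be the size of the syndeticity set, and the
  sixth power bounds the number of conjugates to be handled.\<close>

lemma exists_exponent:
  fixes t :: nat
  shows "\<exists>n. 2 * ((3 * n + 2) * t) ^ 6 < 2 ^ n"
proof -
  have "((\<lambda>n. 2 * ((3 * real n + 2) * real t) ^ 6 / 2 ^ n) \<longlongrightarrow> 0) at_top"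
    by (cases "t = 0") (simp, real_asymp)
  then have "eventually (\<lambda>n. 2 * ((3 * real n + 2) * real t) ^ 6 / 2 ^ n < 1) at_top"
    by (rule order_tendstoD) simp
  then obtain n where "2 * ((3 * real n + 2) * real t) ^ 6 / 2 ^ n < 1"
    by (auto simp: eventually_at_top_linorder)
  then have "real (2 * ((3 * n + 2) * t) ^ 6) < real (2 ^ n)"
    by (simp add: field_simps)
  then show ?thesis by (metis of_nat_less_iff)
qed

text \<open>Joining \<open>k\<close> to \<open>k \<otimes> \<gamma>\<close> gives a graph of degree
  at most two, so a maximal independent set \<open>L\<close> and its two translates by
  \<open>\<gamma>\<close> and \<open>inv \<gamma>\<close> cover \<open>J\<close>.\<close>

lemma (in group) independent_third:
  assumes "finite J" "J \<subseteq> carrier G" "\<gamma> \<in> carrier G" "\<gamma> \<noteq> \<one>"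
  shows "\<exists>L\<subseteq>J. card J \<le> 3 * card L \<and> (\<forall>k\<in>L. k \<otimes> \<gamma> \<notin> L)"
proof -
  define F where "F = {L. L \<subseteq> J \<and> (\<forall>k\<in>L. k \<otimes> \<gamma> \<notin> L)}"
  have "finite F" using assms(1) by (auto simp: F_def)
  moreover have "{} \<in> F" by (auto simp: F_def)
  ultimately obtain L where L: "L \<in> F" and mx: "\<And>L'. L' \<in> F \<Longrightarrow> L \<subseteq> L' \<Longrightarrow> L = L'"
    using finite_has_maximal2 by metis
  have LJ: "L \<subseteq> J" "finite L" using L assms(1) finite_subset by (auto simp: F_def)
  have "J \<subseteq> L \<union> (\<lambda>k. k \<otimes> \<gamma>) ` L \<union> (\<lambda>k. k \<otimes> inv \<gamma>) ` L"
  proof (rule ccontr)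
    assume "\<not> ?thesis"
    then obtain j where j: "j \<in> J" "j \<notin> L" "j \<notin> (\<lambda>k. k \<otimes> \<gamma>) ` L" "j \<notin> (\<lambda>k. k \<otimes> inv \<gamma>) ` L"
      by auto
    have jc: "j \<in> carrier G" using j(1) assms(2) by auto
    have "j \<otimes> \<gamma> \<noteq> j" using jc assms(3,4) by simp
    moreover have "j \<otimes> \<gamma> \<notin> L"
    proof
      assume "j \<otimes> \<gamma> \<in> L"
      then have "j \<otimes> \<gamma> \<otimes> inv \<gamma> \<in> (\<lambda>k. k \<otimes> inv \<gamma>) ` L" by blast
      then show False using j(4) jc assms(3) by (simp add: m_assoc)
    qed
    ultimately have "insert j L \<in> F"
      using L j by (auto simp: F_def)
    then show False using mx[of "insert j L"] j(2) by auto
  qed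
  then have "card J \<le> card (L \<union> (\<lambda>k. k \<otimes> \<gamma>) ` L \<union> (\<lambda>k. k \<otimes> inv \<gamma>) ` L)"
    using LJ(2) by (intro card_mono) auto
  also have "\<dots> \<le> card L + card L + card L"
    using LJ(2) by (intro order.trans[OF card_Un_le] add_mono card_image_le) auto
  finally show ?thesis using L by (auto simp: F_def)
qed

subsection \<open>Separating sets for free Borel actions\<close>

text \<open>The countable Borel family \<open>B\<close> stands in for the standard Borel structure
  of the space; the countable colorings below are read off from it.\<close>

locale free_borel_action = group G for G :: "('g, 'm) monoid_scheme" (structure) +
  fixes X :: "'x measure" and act :: "'g \<Rightarrow> 'x \<Rightarrow> 'x" (infixr \<open>\<cdot>\<close> 66) and B :: "nat \<Rightarrow> 'x set"
  assumes countable_carrier: "countable (carrier G)"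
    and act_measurable: "g \<in> carrier G \<Longrightarrow> act g \<in> measurable X X"
    and act_one [simp]: "x \<in> space X \<Longrightarrow> \<one> \<cdot> x = x"
    and act_mult: "g \<in> carrier G \<Longrightarrow> h \<in> carrier G \<Longrightarrow> x \<in> space X \<Longrightarrow> (g \<otimes> h) \<cdot> x = g \<cdot> h \<cdot> x"
    and act_free: "g \<in> carrier G \<Longrightarrow> x \<in> space X \<Longrightarrow> g \<cdot> x = x \<Longrightarrow> g = \<one>"
    and sets_B [measurable]: "B i \<in> sets X"
    and B_separates: "finite F \<Longrightarrow> x \<in> space X \<Longrightarrow> F \<subseteq> space X \<Longrightarrow> x \<notin> F
      \<Longrightarrow> \<exists>i. x \<in> B i \<and> B i \<inter> F = {}"
begin

lemma act_closed [simp]: "g \<in> carrier G \<Longrightarrow> x \<in> space X \<Longrightarrow> g \<cdot> x \<in> space X"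
  using act_measurable measurable_space by metis

lemma act_inv [simp]:
  assumes "g \<in> carrier G" "x \<in> space X"
  shows "inv g \<cdot> g \<cdot> x = x" "g \<cdot> inv g \<cdot> x = x"
  using assms by (auto simp flip: act_mult)

lemma act_eq_iff:
  assumes "g \<in> carrier G" "h \<in> carrier G" "x \<in> space X"
  shows "g \<cdot> x = h \<cdot> x \<longleftrightarrow> g = h"
proof
  assume "g \<cdot> x = h \<cdot> x"
  then have "(inv h \<otimes> g) \<cdot> x = x" using assms by (simp add: act_mult)
  then have "inv h \<otimes> g = \<one>" using assms by (intro act_free) auto
  then show "g = h" using assms by (metis inv_closed inv_equality inv_inv)
qed simp

lemma act_swap:
  assumes "g \<in> carrier G" "x \<in> space X" "y \<in> space X"
  shows "g \<cdot> x = y \<longleftrightarrow> x = inv g \<cdot> y"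
  using assms by auto

lemma sets_act [measurable]:
  assumes "g \<in> carrier G" "A \<in> sets X"
  shows "Measurable.pred X (\<lambda>x. g \<cdot> x \<in> A)"
  using act_measurable[OF assms(1)] assms(2) by measurable

section \<open>Countable Borel colorings and marker sets\<close>

text \<open>The color of \<open>x\<close> is the least \<open>i\<close> such that \<open>B i\<close>
  contains \<open>x\<close> but none of the finitely many points \<open>e \<cdot> x\<close> with
  \<open>e \<noteq> \<one>\<close>. Freeness keeps \<open>x\<close> off that finite set, and equal
  colors at \<open>x\<close> and \<open>e \<cdot> x\<close> would put \<open>e \<cdot> x\<close>
  both inside and outside one \<open>B i\<close>.\<close>

lemma borel_coloring_nat:
  assumes E: "finite E" "E \<subseteq> carrier G"
  shows "\<exists>c\<in>measurable X (count_space (UNIV :: nat set)).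
    \<forall>x\<in>space X. \<forall>e\<in>E. e \<noteq> \<one> \<longrightarrow> c (e \<cdot> x) \<noteq> c x"
proof
  define P where "P i x \<longleftrightarrow> x \<in> B i \<and> (\<forall>e\<in>E - {\<one>}. e \<cdot> x \<notin> B i)" for i x
  define c where "c x = (LEAST i. P i x)" for x
  have [measurable]: "Measurable.pred X (\<lambda>x. e \<cdot> x \<in> B i)" if "e \<in> E - {\<one>}" for e i
    using that E by (intro sets_act) auto
  have "Measurable.pred X (P i)" for i
    unfolding P_def using E(1)
    by (intro pred_intros_logic pred_intros_finite) (auto intro!: pred_sets2[OF sets_B])
  then show "c \<in> measurable X (count_space UNIV)"
    unfolding c_def by measurable
  have P: "P (c x) x" if x: "x \<in> space X" for x
  proof -
    let ?F = "(\<lambda>e. e \<cdot> x) ` (E - {\<one>})"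
    have "\<exists>i. x \<in> B i \<and> B i \<inter> ?F = {}"
      using x E act_free by (intro B_separates) force+
    then have "\<exists>i. P i x" by (auto simp: P_def)
    then show ?thesis unfolding c_def by (rule LeastI_ex)
  qed
  show "\<forall>x\<in>space X. \<forall>e\<in>E. e \<noteq> \<one> \<longrightarrow> c (e \<cdot> x) \<noteq> c x"
  proof (intro ballI impI notI)
    fix x e assume x: "x \<in> space X" and e: "e \<in> E" "e \<noteq> \<one>" and eq: "c (e \<cdot> x) = c x"
    have "e \<cdot> x \<in> B (c (e \<cdot> x))" using P[of "e \<cdot> x"] x e E by (auto simp: P_def)
    moreover have "e \<cdot> x \<notin> B (c x)" using P[OF x] e by (auto simp: P_def)
    ultimately show False using eq by simp
  qed
qed

text \<open>A greedy maximal independent set for the relation given by \<open>D\<close>, built one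
  color class at a time so that every stage is Borel.\<close>

lemma borel_marker_set:
  assumes D: "finite D" "D \<subseteq> carrier G" "\<one> \<in> D" "\<And>d. d \<in> D \<Longrightarrow> inv d \<in> D"
  obtains M where "M \<in> sets X"
    "\<And>x d. x \<in> M \<Longrightarrow> d \<in> D \<Longrightarrow> d \<cdot> x \<in> M \<Longrightarrow> d = \<one>"
    "\<And>x. x \<in> space X \<Longrightarrow> \<exists>d\<in>D. d \<cdot> x \<in> M"
proof -
  obtain c where [measurable]: "c \<in> measurable X (count_space (UNIV :: nat set))"
    and c: "\<And>x e. x \<in> space X \<Longrightarrow> e \<in> D \<Longrightarrow> e \<noteq> \<one> \<Longrightarrow> c (e \<cdot> x) \<noteq> c x"
    using borel_coloring_nat[OF D(1,2)] by blast
  define F where "F = rec_nat {} (\<lambda>i A. A \<union> {x \<in> space X. c x = i \<and> (\<forall>d\<in>D. d \<cdot> x \<notin> A)})"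
  have F0: "F 0 = {}" and FS: "F (Suc i) = F i \<union> {x \<in> space X. c x = i \<and> (\<forall>d\<in>D. d \<cdot> x \<notin> F i)}" for i
    by (simp_all add: F_def)
  have mF: "F i \<in> sets X" for i
  proof (induction i)
    case (Suc i)
    then have [measurable]: "Measurable.pred X (\<lambda>x. d \<cdot> x \<in> F i)" if "d \<in> D" for d
      using that D by (intro sets_act) auto
    show ?case unfolding FS using D(1) Suc by measurable
  qed (simp add: F0)
  have mono: "F i \<subseteq> F j" if "i \<le> j" for i j
    using that by (rule lift_Suc_mono_le[of F, rotated]) (auto simp: FS)
  have Fc: "x \<in> space X \<and> c x < i \<and> (\<forall>d\<in>D. d \<cdot> x \<notin> F (c x))" if "x \<in> F i" for x i
    using that by (induction i) (auto simp: F0 FS)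
  define M where "M = (\<Union>i. F i)"
  \<comment> \<open>A chosen neighbour of smaller color would already have been present when
    \<open>x\<close> was considered. Using this for \<open>d\<close> and for \<open>inv d\<close>
    leaves only equal colors, which the coloring forbids unless \<open>d = \<one>\<close>.\<close>
  have sep: "\<not> c (d \<cdot> x) < c x" if st: "x \<in> M" "d \<in> D" "d \<cdot> x \<in> M" for x d
  proof
    assume lt: "c (d \<cdot> x) < c x"
    obtain i where "d \<cdot> x \<in> F i" using st by (auto simp: M_def)
    then have "d \<cdot> x \<in> F (Suc (c (d \<cdot> x)))"
    proof (induction i)
      case (Suc i) then show ?case using mono by (auto simp: FS)
    qed (simp add: F0)
    then have "d \<cdot> x \<in> F (c x)" using mono[of "Suc (c (d \<cdot> x))" "c x"] lt by auto
    moreover obtain j where "x \<in> F j" using st by (auto simp: M_def)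
    ultimately show False using Fc st by blast
  qed
  show thesis
  proof
    show "M \<in> sets X" unfolding M_def using mF by auto
    fix x d assume x: "x \<in> M" "d \<in> D" "d \<cdot> x \<in> M"
    have xs: "x \<in> space X" using x Fc by (auto simp: M_def)
    have "\<not> c (d \<cdot> x) < c x" using sep x by blast
    moreover have "\<not> c (inv d \<cdot> d \<cdot> x) < c (d \<cdot> x)"
      using sep[of "d \<cdot> x" "inv d"] x xs D by auto
    ultimately have "c (d \<cdot> x) = c x" using x xs D by auto
    then show "d = \<one>" using c x xs by blast
  next
    fix x assume x: "x \<in> space X"
    show "\<exists>d\<in>D. d \<cdot> x \<in> M"
    proof (rule ccontr)
      assume n: "\<not> ?thesis"
      \<comment> \<open>No chosen point blocks \<open>x\<close>, so \<open>x\<close> itself is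
        chosen at the stage of its color; \<open>\<one> \<in> D\<close> then gives the
        contradiction.\<close>
      then have "x \<in> F (Suc (c x))" using x by (auto simp: FS M_def)
      then show False using n D(3) x by (force simp: M_def)
    qed
  qed
qed

section \<open>Windows and separating labels\<close>

text \<open>Each induction step adds a translate of \<open>T\<close> disjoint from the window so
  far; it contributes at least one new point of \<open>U\<close> at every \<open>x\<close>.\<close>

lemma large_window:
  assumes T: "finite T" "T \<subseteq> carrier G" "\<forall>x\<in>space X. \<exists>t\<in>T. t \<cdot> x \<in> U"
    and inf: "infinite (carrier G)"
  shows "\<exists>W. finite W \<and> W \<subseteq> carrier G \<and> card W \<le> N * card T \<and>
    (\<forall>x\<in>space X. N \<le> card {w \<in> W. w \<cdot> x \<in> U})"
proof (induction N)
  case 0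
  show ?case by (rule exI[of _ "{}"]) auto
next
  case (Suc N)
  then obtain W where W: "finite W" "W \<subseteq> carrier G" "card W \<le> N * card T"
    "\<And>x. x \<in> space X \<Longrightarrow> N \<le> card {w \<in> W. w \<cdot> x \<in> U}" by blast
  have "finite ((\<lambda>(t, w). inv t \<otimes> w) ` (T \<times> W))" using T W by auto
  \<comment> \<open>Avoiding all \<open>inv t \<otimes> w\<close> is what makes the translate of
    \<open>T\<close> by \<open>h\<close> disjoint from \<open>W\<close>.\<close>
  then obtain h where h: "h \<in> carrier G" "h \<notin> (\<lambda>(t, w). inv t \<otimes> w) ` (T \<times> W)"
    using inf by (meson finite_subset subsetI)
  let ?W = "W \<union> (\<lambda>t. t \<otimes> h) ` T"
  have disj: "t \<otimes> h \<notin> W" if "t \<in> T" for t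
  proof
    assume w: "t \<otimes> h \<in> W"
    have "h = inv t \<otimes> (t \<otimes> h)" using that T h by (simp add: subset_iff flip: m_assoc)
    then show False using h(2) that w by force
  qed
  have "Suc N \<le> card {w \<in> ?W. w \<cdot> x \<in> U}" if x: "x \<in> space X" for x
  proof -
    obtain t where t: "t \<in> T" "t \<cdot> h \<cdot> x \<in> U" using bspec[OF T(3), of "h \<cdot> x"] x h by auto
    have "insert (t \<otimes> h) {w \<in> W. w \<cdot> x \<in> U} \<subseteq> {w \<in> ?W. w \<cdot> x \<in> U}"
      using t T h x by (auto simp: act_mult subset_iff)
    then have "card (insert (t \<otimes> h) {w \<in> W. w \<cdot> x \<in> U}) \<le> card {w \<in> ?W. w \<cdot> x \<in> U}"
      using W T by (intro card_mono) auto
    then show ?thesis using disj[OF t(1)] W(1) W(4)[OF x] by simp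
  qed
  moreover have "card ?W \<le> Suc N * card T"
    using card_Un_le[of W "(\<lambda>t. t \<otimes> h) ` T"] card_image_le[OF T(1), of "\<lambda>t. t \<otimes> h"] W(3) by simp
  moreover have "?W \<subseteq> carrier G" using W T h by auto
  ultimately show ?case using W(1) T(1) by (intro exI[of _ ?W]) auto
qed


lemma pred_act:
  assumes "g \<in> carrier G" "Measurable.pred X Q"
  shows "Measurable.pred X (\<lambda>x. Q (g \<cdot> x))"
  by (rule measurable_compose[OF act_measurable[OF assms(1)] assms(2)])

text \<open>\<open>V\<close> holds the points kept undecided, \<open>P\<close> those already filled,
  and \<open>K\<close> the positions free to be labelled. A label that fails for
  \<open>\<gamma>\<close> is determined by its part outside an independent set
  \<open>L \<gamma>\<close>, since the value at \<open>k\<close> in \<open>L \<gamma>\<close> is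
  copied from \<open>k \<otimes> \<gamma>\<close>, which lies outside. The union bound then
  applies.\<close>

lemma exists_separating_label:
  assumes W: "finite W" "W \<subseteq> carrier G" and m: "m \<in> space X"
    and \<Gamma>: "finite \<Gamma>" "\<Gamma> \<subseteq> carrier G" "\<one> \<notin> \<Gamma>" "card \<Gamma> < 2 ^ n"
    and K: "K \<subseteq> {k \<in> W. k \<cdot> m \<notin> V \<and> k \<cdot> m \<notin> P}"
    and J: "\<And>\<gamma>. \<gamma> \<in> \<Gamma> \<Longrightarrow> 3 * n \<le> card {k \<in> K. (k \<otimes> \<gamma>) \<cdot> m \<notin> V}"
  shows "\<exists>s\<subseteq>K. \<forall>\<gamma>\<in>\<Gamma>. \<exists>k\<in>W. k \<cdot> m \<notin> V \<and> (k \<otimes> \<gamma>) \<cdot> m \<notin> V \<and>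
    (k \<cdot> m \<in> P \<or> k \<in> s) \<noteq> ((k \<otimes> \<gamma>) \<cdot> m \<in> P \<or> k \<otimes> \<gamma> \<in> s)"
proof -
  have finK: "finite K" using K W(1) by (auto intro: finite_subset)
  have "\<exists>L\<subseteq>{k \<in> K. (k \<otimes> \<gamma>) \<cdot> m \<notin> V}. n \<le> card L \<and> (\<forall>k\<in>L. k \<otimes> \<gamma> \<notin> L)"
    if \<gamma>: "\<gamma> \<in> \<Gamma>" for \<gamma>
  proof -
    have "finite {k \<in> K. (k \<otimes> \<gamma>) \<cdot> m \<notin> V}" using finK by auto
    moreover have "{k \<in> K. (k \<otimes> \<gamma>) \<cdot> m \<notin> V} \<subseteq> carrier G" using K W(2) by auto
    moreover have "\<gamma> \<in> carrier G" "\<gamma> \<noteq> \<one>" using \<gamma> \<Gamma> by auto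
    ultimately obtain L where L: "L \<subseteq> {k \<in> K. (k \<otimes> \<gamma>) \<cdot> m \<notin> V}"
      "card {k \<in> K. (k \<otimes> \<gamma>) \<cdot> m \<notin> V} \<le> 3 * card L" "\<forall>k\<in>L. k \<otimes> \<gamma> \<notin> L"
      by (meson independent_third)
    moreover have "n \<le> card L" using L(2) J[OF \<gamma>] by simp
    ultimately show ?thesis by blast
  qed
  then have "\<forall>\<gamma>\<in>\<Gamma>. \<exists>L. L \<subseteq> {k \<in> K. (k \<otimes> \<gamma>) \<cdot> m \<notin> V} \<and> n \<le> card L \<and>
      (\<forall>k\<in>L. k \<otimes> \<gamma> \<notin> L)" by simp
  from bchoice[OF this] obtain L where
    "\<forall>\<gamma>\<in>\<Gamma>. L \<gamma> \<subseteq> {k \<in> K. (k \<otimes> \<gamma>) \<cdot> m \<notin> V} \<and> n \<le> card (L \<gamma>) \<and>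
      (\<forall>k\<in>L \<gamma>. k \<otimes> \<gamma> \<notin> L \<gamma>)" ..
  then have L: "\<And>\<gamma>. \<gamma> \<in> \<Gamma> \<Longrightarrow> L \<gamma> \<subseteq> {k \<in> K. (k \<otimes> \<gamma>) \<cdot> m \<notin> V}"
    "\<And>\<gamma>. \<gamma> \<in> \<Gamma> \<Longrightarrow> n \<le> card (L \<gamma>)"
    "\<And>\<gamma> k. \<gamma> \<in> \<Gamma> \<Longrightarrow> k \<in> L \<gamma> \<Longrightarrow> k \<otimes> \<gamma> \<notin> L \<gamma>"
    by blast+
  define Bad where "Bad \<gamma> = {s. s \<subseteq> K \<and> (\<forall>k\<in>L \<gamma>. k \<in> s \<longleftrightarrow> (k \<otimes> \<gamma>) \<cdot> m \<in> P \<or> k \<otimes> \<gamma> \<in> s)}" for \<gamma>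
  have "inj_on (\<lambda>s. s - L \<gamma>) (Bad \<gamma>)" if \<gamma>: "\<gamma> \<in> \<Gamma>" for \<gamma>
  proof (rule inj_onI)
    fix s t assume s: "s \<in> Bad \<gamma>" and t: "t \<in> Bad \<gamma>" and eq: "s - L \<gamma> = t - L \<gamma>"
    have out: "k \<in> s \<longleftrightarrow> k \<in> t" if "k \<notin> L \<gamma>" for k using eq that by blast
    then have "k \<in> s \<longleftrightarrow> k \<in> t" if "k \<in> L \<gamma>" for k
      using s t L(3)[OF \<gamma> that] that by (auto simp: Bad_def)
    with out show "s = t" by blast
  qed
  then obtain s where s: "s \<subseteq> K" "\<And>\<gamma>. \<gamma> \<in> \<Gamma> \<Longrightarrow> s \<notin> Bad \<gamma>"
    using avoid_bad_sets[OF finK \<Gamma>(1,4), of L Bad] L(1,2) by (force simp: Bad_def)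
  show ?thesis
  proof (intro exI[of _ s] conjI ballI)
    fix \<gamma> assume \<gamma>: "\<gamma> \<in> \<Gamma>"
    then obtain k where k: "k \<in> L \<gamma>" "(k \<in> s) \<noteq> ((k \<otimes> \<gamma>) \<cdot> m \<in> P \<or> k \<otimes> \<gamma> \<in> s)"
      using s by (auto simp: Bad_def)
    then show "\<exists>k\<in>W. k \<cdot> m \<notin> V \<and> (k \<otimes> \<gamma>) \<cdot> m \<notin> V \<and>
      (k \<cdot> m \<in> P \<or> k \<in> s) \<noteq> ((k \<otimes> \<gamma>) \<cdot> m \<in> P \<or> k \<otimes> \<gamma> \<in> s)"
      using L(1)[OF \<gamma>] K by (intro bexI[of _ k]) auto
  qed (use s in auto)
qed

text \<open>
  \<open>P\<close> holds the points already put into \<open>A\<close>, and \<open>U\<close> the undecided ones. The last conjunct survives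
  all later stages because they only change points of \<open>U'\<close>.
\<close>

lemma separation_step:
  assumes inf: "infinite (carrier G)" and ne: "space X \<noteq> {}"
    and g: "g \<in> carrier G" "g \<noteq> \<one>"
    and [measurable]: "P \<in> sets X" "U \<in> sets X" and PU: "P \<inter> U = {}"
    and T: "finite T" "T \<subseteq> carrier G" "\<forall>x\<in>space X. \<exists>t\<in>T. t \<cdot> x \<in> U"
  shows "\<exists>P' U' T'. P' \<in> sets X \<and> U' \<in> sets X \<and> P' \<inter> U' = {} \<and>
    P \<subseteq> P' \<and> P' \<subseteq> P \<union> U \<and> U' \<subseteq> U \<and>
    finite T' \<and> T' \<subseteq> carrier G \<and> (\<forall>x\<in>space X. \<exists>t\<in>T'. t \<cdot> x \<in> U') \<and>
    (\<forall>x\<in>space X. \<exists>h\<in>carrier G. h \<cdot> x \<notin> U' \<and> h \<cdot> g \<cdot> x \<notin> U' \<and>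
      (h \<cdot> x \<in> P') \<noteq> (h \<cdot> g \<cdot> x \<in> P'))"
proof -
  \<comment> \<open>Of the \<open>3 * n + 2\<close> undecided points of a window, one is kept back
    and at most one position \<open>k\<close> is lost because
    \<open>(k \<otimes> \<gamma>) \<cdot> m\<close> is kept back. An independent third of the
    remaining \<open>3 * n\<close> has size at least \<open>n\<close>.\<close>
  obtain n where n: "2 * ((3 * n + 2) * card T) ^ 6 < 2 ^ n" using exists_exponent by blast
  from large_window[OF T inf, of "3 * n + 2"] obtain W where
    "finite W \<and> W \<subseteq> carrier G \<and> card W \<le> (3 * n + 2) * card T \<and>
      (\<forall>x\<in>space X. 3 * n + 2 \<le> card {w \<in> W. w \<cdot> x \<in> U})" ..
  then have W: "finite W" "W \<subseteq> carrier G" "card W \<le> (3 * n + 2) * card T"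
    "\<And>x. x \<in> space X \<Longrightarrow> 3 * n + 2 \<le> card {w \<in> W. w \<cdot> x \<in> U}"
    by blast+
  have Wc: "w \<in> carrier G" if "w \<in> W" for w using that W by auto
  have ex_w: "\<exists>w\<in>W. w \<cdot> x \<in> U" if "x \<in> space X" for x
    using W(4)[OF that] by (cases "{w \<in> W. w \<cdot> x \<in> U} = {}") auto
  then have Wne: "W \<noteq> {}" using ne by auto
  \<comment> \<open>\<open>Q\<close> holds the displacements between positions of a window, so
    markers separated by \<open>D\<close> have disjoint \<open>Q\<close>-neighbourhoods.
    \<open>C\<close> holds the conjugators used later: \<open>d\<close> moves a point to a marker,
    and a further factor from \<open>Q\<close> moves on to a second marker.\<close>
  define Q where "Q = (\<lambda>(w, w'). inv w \<otimes> w') ` (W \<times> W)"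
  define D where "D = (\<lambda>(p, q). p \<otimes> q) ` (Q \<times> Q)"
  define C where "C = (\<lambda>(p, d). p \<otimes> d) ` (Q \<times> D)"
  define \<Gamma> where "\<Gamma> = (\<lambda>(u, f). f \<otimes> u \<otimes> inv f) ` ({g, inv g} \<times> C)"
  have QI: "inv w \<otimes> w' \<in> Q" if "w \<in> W" "w' \<in> W" for w w' using that by (auto simp: Q_def)
  have DI: "p \<otimes> q \<in> D" if "p \<in> Q" "q \<in> Q" for p q using that by (auto simp: D_def)
  have CI: "p \<otimes> d \<in> C" if "p \<in> Q" "d \<in> D" for p d using that by (auto simp: C_def)
  have \<Gamma>I: "f \<otimes> g \<otimes> inv f \<in> \<Gamma>" "f \<otimes> inv g \<otimes> inv f \<in> \<Gamma>" if "f \<in> C" for f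
    using that by (auto simp: \<Gamma>_def image_iff)
  have fin: "finite Q" "finite D" "finite C" "finite \<Gamma>"
    using W(1) by (auto simp: Q_def D_def C_def \<Gamma>_def)
  have Qc: "Q \<subseteq> carrier G" using Wc by (auto simp: Q_def)
  have Dc: "D \<subseteq> carrier G" using Qc by (auto simp: D_def subset_iff)
  have Cc: "C \<subseteq> carrier G" using Qc Dc by (auto simp: C_def subset_iff)
  have \<Gamma>c: "\<Gamma> \<subseteq> carrier G" using Cc g by (auto simp: \<Gamma>_def subset_iff)
  have Q1: "\<one> \<in> Q" using Wne Wc QI by (metis all_not_in_conv l_inv)
  have D1: "\<one> \<in> D" using DI[OF Q1 Q1] by simp
  have DC: "D \<subseteq> C" using CI[OF Q1] Dc by force
  have Qinv: "inv q \<in> Q" if "q \<in> Q" for q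
    using that Wc by (auto simp: Q_def inv_mult_group intro: rev_image_eqI)
  have Dinv: "inv d \<in> D" if "d \<in> D" for d
  proof -
    obtain p q where pq: "d = p \<otimes> q" "p \<in> Q" "q \<in> Q" using \<open>d \<in> D\<close> by (auto simp: D_def)
    moreover have "p \<in> carrier G" "q \<in> carrier G" using pq Qc by auto
    ultimately have "inv d = inv q \<otimes> inv p" by (simp add: inv_mult_group)
    then show ?thesis using DI Qinv pq by auto
  qed
  have conj_ne: "f \<otimes> u \<otimes> inv f \<noteq> \<one>" if "f \<in> carrier G" "u \<in> carrier G" "u \<noteq> \<one>" for f u
  proof
    assume "f \<otimes> u \<otimes> inv f = \<one>"
    then have "f \<otimes> u \<otimes> inv f \<otimes> f = f" using that by simp
    then have "f \<otimes> u = f" using that by (simp add: m_assoc)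
    then show False using that by simp
  qed
  have \<Gamma>1: "\<one> \<notin> \<Gamma>"
  proof -
    have "inv g \<noteq> \<one>" using g by (metis inv_inv inv_one)
    then show ?thesis using conj_ne Cc g by (auto simp: \<Gamma>_def subset_iff dest: sym[of \<one>])
  qed
  have card\<Gamma>: "card \<Gamma> < 2 ^ n"
  proof -
    have cQ: "card Q \<le> card W ^ 2"
      unfolding Q_def using card_image_le[of "W \<times> W"] W(1)
      by (metis card_cartesian_product finite_cartesian_product power2_eq_square)
    have cD: "card D \<le> card Q * card Q"
      unfolding D_def using card_image_le[of "Q \<times> Q"] fin
      by (metis card_cartesian_product finite_cartesian_product)
    have cC: "card C \<le> card Q * card D"
      unfolding C_def using card_image_le[of "Q \<times> D"] fin
      by (metis card_cartesian_product finite_cartesian_product)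
    have "card \<Gamma> \<le> card ({g, inv g} \<times> C)"
      unfolding \<Gamma>_def using fin by (intro card_image_le) auto
    also have "\<dots> \<le> 2 * card C"
      by (simp add: card_cartesian_product card_insert_if)
    also have "\<dots> \<le> 2 * (card Q * (card Q * card Q))"
      using cC cD by (meson le_trans mult_le_mono2)
    also have "\<dots> \<le> 2 * (card W ^ 2 * (card W ^ 2 * card W ^ 2))"
      using cQ by (intro mult_le_mono) auto
    also have "\<dots> = 2 * card W ^ 6" by (simp flip: power_add)
    also have "\<dots> \<le> 2 * ((3 * n + 2) * card T) ^ 6" using W(3) by (intro mult_le_mono2 power_mono) auto
    also note n
    finally show ?thesis .
  qed

  obtain M where [measurable]: "M \<in> sets X"
    and M_sep: "\<And>x d. x \<in> M \<Longrightarrow> d \<in> D \<Longrightarrow> d \<cdot> x \<in> M \<Longrightarrow> d = \<one>"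
    and M_cov: "\<And>x. x \<in> space X \<Longrightarrow> \<exists>d\<in>D. d \<cdot> x \<in> M"
    using borel_marker_set[OF fin(2) Dc D1 Dinv] by blast
  have Mx: "m \<in> space X" if "m \<in> M" for m
    using that sets.sets_into_space[OF \<open>M \<in> sets X\<close>] by auto
  \<comment> \<open>The element \<open>inv q' \<otimes> q\<close> of \<open>D\<close> carries one
    marker to another, so it is trivial.\<close>
  have uniq: "m = m'" "q = q'" if "m \<in> M" "m' \<in> M" "q \<in> Q" "q' \<in> Q" "q \<cdot> m = q' \<cdot> m'" for m m' q q'
  proof -
    have c: "q \<in> carrier G" "q' \<in> carrier G" using that Qc by auto
    have e: "(inv q' \<otimes> q) \<cdot> m = m'"
      using that c Mx by (simp add: act_mult)
    then have "inv q' \<otimes> q = \<one>"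
      using M_sep[OF that(1) DI[OF Qinv[OF that(4)] that(3)]] that by simp
    then show "q = q'" "m = m'"
      using e c Mx[OF that(1)] by (auto simp: inv_equality) (metis inv_closed inv_equality inv_inv)
  qed
  \<comment> \<open>Windows of different markers are disjoint.\<close>
  have uniqW: "m = m' \<and> w = w'" if "m \<in> M" "m' \<in> M" "w \<in> W" "w' \<in> W" "w \<cdot> m = w' \<cdot> m'" for m m' w w'
  proof -
    have "\<one> \<cdot> m = (inv w \<otimes> w') \<cdot> m'"
      using that(1-4) Wc Mx by (simp add: act_mult that(5)[symmetric])
    then have "m = m'" "\<one> = inv w \<otimes> w'"
      using uniq[OF that(1,2) Q1 QI[OF that(3,4)]] by auto
    moreover have "w \<in> carrier G" "w' \<in> carrier G" using that Wc by auto
    ultimately show ?thesis by (metis inv_closed inv_equality inv_inv)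
  qed

  have "countable W" using W(1) by (rule countable_finite)
  \<comment> \<open>The first position of \<open>W\<close>, in a fixed enumeration, whose point is
    undecided; taking the least index keeps the choice Borel.\<close>
  define k0 where "k0 x = from_nat_into W (LEAST i. from_nat_into W i \<cdot> x \<in> U)" for x
  have k0W: "k0 x \<in> W" for x unfolding k0_def using Wne by (rule from_nat_into)
  have k0U: "k0 x \<cdot> x \<in> U" if "x \<in> space X" for x
  proof -
    have "\<exists>i. from_nat_into W i \<cdot> x \<in> U"
      using ex_w[OF that] from_nat_into_surj[OF \<open>countable W\<close>] by metis
    then show ?thesis unfolding k0_def by (rule LeastI_ex)
  qed
  have k0_meas: "Measurable.pred X (\<lambda>x. k0 x = w)" for w
  proof -
    have [measurable]: "Measurable.pred X (\<lambda>x. from_nat_into W i \<cdot> x \<in> U)" for i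
      using Wc from_nat_into[OF Wne] by (intro sets_act) auto
    have "(\<lambda>x. LEAST i. from_nat_into W i \<cdot> x \<in> U) \<in> measurable X (count_space UNIV)"
      by measurable
    from measurable_compose[OF this, of "\<lambda>i. from_nat_into W i = w" "count_space UNIV"]
    show ?thesis by (simp add: k0_def)
  qed
  \<comment> \<open>the points \<open>k0 m \<cdot> m\<close>, one per window, that remain undecided\<close>
  define V where "V = {y \<in> space X. \<exists>w\<in>W. inv w \<cdot> y \<in> M \<and> k0 (inv w \<cdot> y) = w}"
  have V_iff: "y \<in> V \<longleftrightarrow> (\<exists>m\<in>M. y = k0 m \<cdot> m)" for y
  proof
    assume "y \<in> V"
    then obtain w where "y \<in> space X" "w \<in> W" "inv w \<cdot> y \<in> M" "k0 (inv w \<cdot> y) = w"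
      by (auto simp: V_def)
    then show "\<exists>m\<in>M. y = k0 m \<cdot> m" using Wc by (intro bexI[of _ "inv w \<cdot> y"]) auto
  next
    assume "\<exists>m\<in>M. y = k0 m \<cdot> m"
    then obtain m where m: "m \<in> M" "y = k0 m \<cdot> m" by auto
    then show "y \<in> V"
      unfolding V_def using k0W[of m] Wc Mx by (auto intro!: bexI[of _ "k0 m"])
  qed
  have V_meas [measurable]: "V \<in> sets X"
  proof -
    have [measurable]: "Measurable.pred X (\<lambda>y. inv w \<cdot> y \<in> M)" if "w \<in> W" for w
      using that Wc by (intro sets_act) auto
    have [measurable]: "Measurable.pred X (\<lambda>y. k0 (inv w \<cdot> y) = w)" if "w \<in> W" for w
      using that Wc by (intro pred_act[OF _ k0_meas]) auto
    show ?thesis unfolding V_def using W(1) by measurable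
  qed

  \<comment> \<open>If \<open>\<gamma> \<cdot> m\<close> is \<open>Q\<close>-close to a marker
    \<open>m'\<close>, then an element of \<open>E\<close> carries \<open>m\<close> to
    \<open>m'\<close>. Distinct markers that interact in this way therefore get different colors and
    are filled at different stages.\<close>
  define E where "E = (\<lambda>(q, \<gamma>). q \<otimes> \<gamma>) ` (Q \<times> \<Gamma>)"
  have "finite E" "E \<subseteq> carrier G" using fin Qc \<Gamma>c by (auto simp: E_def subset_iff)
  from borel_coloring_nat[OF this] obtain c
    where c_meas [measurable]: "c \<in> measurable X (count_space (UNIV :: nat set))"
    and c_proper: "\<forall>x\<in>space X. \<forall>e\<in>E. e \<noteq> \<one> \<longrightarrow> c (e \<cdot> x) \<noteq> c x" ..

  \<comment> \<open>\<open>A\<close> is the set filled so far and \<open>s\<close> the positions to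
    be filled now. The point \<open>(k \<otimes> \<gamma>) \<cdot> x\<close> may lie in the same
    window, hence the disjunct \<open>k \<otimes> \<gamma> \<in> s\<close>.\<close>
  define good where "good A x s \<longleftrightarrow> s \<subseteq> {k \<in> W. k \<cdot> x \<in> U \<and> k \<cdot> x \<notin> V} \<and>
    (\<forall>\<gamma>\<in>\<Gamma>. \<exists>k\<in>W. k \<cdot> x \<notin> V \<and> (k \<otimes> \<gamma>) \<cdot> x \<notin> V \<and>
      (k \<cdot> x \<in> A \<or> k \<in> s) \<noteq> ((k \<otimes> \<gamma>) \<cdot> x \<in> A \<or> k \<otimes> \<gamma> \<in> s))" for A x s
  \<comment> \<open>A Borel choice of label by least index. Without a good label the value is still
    a subset of \<open>W\<close>; \<open>sel_ok\<close> excludes that case for each marker at its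
    own stage.\<close>
  define sel where "sel A x = from_nat_into (Pow W) (LEAST i. good A x (from_nat_into (Pow W) i))" for A x
  have good_meas: "Measurable.pred X (\<lambda>x. good A x s)" if "A \<in> sets X" for A s
  proof -
    \<comment> \<open>As \<open>s\<close> is an arbitrary set, the inclusion is split so that the
      quantifiers whose bodies depend on \<open>x\<close> range over finite sets only.\<close>
    have eq: "good A x s \<longleftrightarrow> (\<forall>k\<in>s. k \<in> W) \<and> (\<forall>k\<in>s \<inter> W. k \<cdot> x \<in> U \<and> k \<cdot> x \<notin> V) \<and>
      (\<forall>\<gamma>\<in>\<Gamma>. \<exists>k\<in>W. k \<cdot> x \<notin> V \<and> (k \<otimes> \<gamma>) \<cdot> x \<notin> V \<and>
      (k \<cdot> x \<in> A \<or> k \<in> s) \<noteq> ((k \<otimes> \<gamma>) \<cdot> x \<in> A \<or> k \<otimes> \<gamma> \<in> s))" for x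
      unfolding good_def by auto
    have [measurable]: "Measurable.pred X (\<lambda>x. k \<cdot> x \<in> U)" "Measurable.pred X (\<lambda>x. k \<cdot> x \<in> V)"
      "Measurable.pred X (\<lambda>x. k \<cdot> x \<in> A)" if "k \<in> W" for k
      using that Wc \<open>A \<in> sets X\<close> by (intro sets_act; simp)+
    have [measurable]: "Measurable.pred X (\<lambda>x. (k \<otimes> \<gamma>) \<cdot> x \<in> V)"
      "Measurable.pred X (\<lambda>x. (k \<otimes> \<gamma>) \<cdot> x \<in> A)" if "k \<in> W" "\<gamma> \<in> \<Gamma>" for k \<gamma>
      using that Wc \<Gamma>c \<open>A \<in> sets X\<close> by (intro sets_act; auto)+
    have [simp]: "finite (s \<inter> W)" using W(1) by auto
    show ?thesis unfolding eq using W(1) fin by measurable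
  qed
  have sel_meas: "Measurable.pred X (\<lambda>x. w \<in> sel A x)" if "A \<in> sets X" for A w
  proof -
    note [measurable] = good_meas[OF that]
    have "(\<lambda>x. LEAST i. good A x (from_nat_into (Pow W) i)) \<in> measurable X (count_space UNIV)"
      by measurable
    from measurable_compose[OF this, of "\<lambda>i. w \<in> from_nat_into (Pow W) i" "count_space UNIV"]
    show ?thesis by (simp add: sel_def)
  qed
  have selW: "sel A x \<subseteq> W" for A x
    unfolding sel_def using from_nat_into[of "Pow W"] by auto
  have sel_good: "good A x (sel A x)" if "good A x s" for A x s
  proof -
    have "s \<in> Pow W" using that by (auto simp: good_def)
    then have "\<exists>i. good A x (from_nat_into (Pow W) i)"
      using that from_nat_into_surj[of "Pow W" s] W(1) by (metis countable_finite finite_Pow_iff)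
    then show ?thesis unfolding sel_def by (rule LeastI_ex)
  qed

  \<comment> \<open>At step \<open>i\<close> the windows of the markers of color \<open>i\<close> are filled.\<close>
  define F where "F = rec_nat P (\<lambda>i A. A \<union>
    {y \<in> space X. \<exists>w\<in>W. inv w \<cdot> y \<in> M \<and> c (inv w \<cdot> y) = i \<and> w \<in> sel A (inv w \<cdot> y)})"
  have F0: "F 0 = P" and FS': "F (Suc i) = F i \<union>
    {y \<in> space X. \<exists>w\<in>W. inv w \<cdot> y \<in> M \<and> c (inv w \<cdot> y) = i \<and> w \<in> sel (F i) (inv w \<cdot> y)}" for i
    by (simp_all add: F_def)
  \<comment> \<open>The same set described from the markers; the form with \<open>inv w\<close>
    serves measurability.\<close>
  have FS: "y \<in> F (Suc i) \<longleftrightarrow> y \<in> F i \<or> (\<exists>m\<in>M. c m = i \<and> (\<exists>w\<in>sel (F i) m. y = w \<cdot> m))" for y i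
  proof -
    have "(y \<in> space X \<and> (\<exists>w\<in>W. inv w \<cdot> y \<in> M \<and> c (inv w \<cdot> y) = i \<and> w \<in> sel (F i) (inv w \<cdot> y)))
      \<longleftrightarrow> (\<exists>m\<in>M. c m = i \<and> (\<exists>w\<in>sel (F i) m. y = w \<cdot> m))" (is "?l \<longleftrightarrow> ?r")
    proof
      assume ?l
      then obtain w where "y \<in> space X" "w \<in> W" "inv w \<cdot> y \<in> M" "c (inv w \<cdot> y) = i" "w \<in> sel (F i) (inv w \<cdot> y)"
        by auto
      then show ?r using Wc by (intro bexI[of _ "inv w \<cdot> y"] conjI bexI[of _ w]) auto
    next
      assume ?r
      then obtain m w where mw: "m \<in> M" "c m = i" "w \<in> sel (F i) m" "y = w \<cdot> m" by auto
      then have "w \<in> W" using selW by auto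
      then show ?l using mw Wc Mx by (auto intro!: bexI[of _ w])
    qed
    then show ?thesis unfolding FS' by blast
  qed
  have F_meas: "F i \<in> sets X" for i
  proof (induction i)
    case (Suc i)
    have [measurable]: "Measurable.pred X (\<lambda>y. inv w \<cdot> y \<in> M)" if "w \<in> W" for w
      using that Wc by (intro sets_act) auto
    have [measurable]: "Measurable.pred X (\<lambda>y. w \<in> sel (F i) (inv w \<cdot> y))" if "w \<in> W" for w
      using that Wc by (intro pred_act[OF _ sel_meas[OF Suc]]) auto
    have "Measurable.pred X (\<lambda>y. c y = i)" by measurable
    then have [measurable]: "Measurable.pred X (\<lambda>y. c (inv w \<cdot> y) = i)" if "w \<in> W" for w
      using that Wc by (intro pred_act) auto
    show ?case unfolding FS' using W(1) Suc by measurable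
  qed (simp add: F0)
  have F_mono: "F i \<subseteq> F j" if "i \<le> j" for i j
    using that by (rule lift_Suc_mono_le[of F, rotated]) (auto simp: FS)
  have F_cases: "y \<in> P \<or> (\<exists>m\<in>M. c m < i \<and> (\<exists>w\<in>sel (F (c m)) m. y = w \<cdot> m))" if "y \<in> F i" for y i
    using that
  proof (induction i)
    case (Suc i) then show ?case unfolding FS using less_Suc_eq by blast
  qed (simp add: F0)
  have F_new: "y \<in> F j" if "m \<in> M" "c m < j" "w \<in> sel (F (c m)) m" "y = w \<cdot> m" for m j w y
  proof -
    have "y \<in> F (Suc (c m))" unfolding FS using that by blast
    then show ?thesis using F_mono[of "Suc (c m)" j] that(2) by auto
  qed

  have sel_ok: "good (F (c m)) m (sel (F (c m)) m)" if m: "m \<in> M" for m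
  proof -
    define K where "K = {k \<in> W. k \<cdot> m \<in> U \<and> k \<cdot> m \<notin> V}"
    have finK: "finite K" using W(1) by (auto simp: K_def)
    \<comment> \<open>Such a point could only have been filled from the window of an earlier marker,
      but windows of different markers are disjoint.\<close>
    have "k \<cdot> m \<notin> F (c m)" if "k \<in> K" for k
    proof
      assume "k \<cdot> m \<in> F (c m)"
      moreover have "k \<cdot> m \<notin> P" using that PU by (auto simp: K_def)
      ultimately obtain m' w where m': "m' \<in> M" "c m' < c m" "w \<in> sel (F (c m')) m'" "k \<cdot> m = w \<cdot> m'"
        using F_cases by blast
      then have "m = m'" using uniqW[OF m m'(1), of k w] selW that by (auto simp: K_def)
      then show False using m' by simp
    qed
    then have K: "K \<subseteq> {k \<in> W. k \<cdot> m \<notin> V \<and> k \<cdot> m \<notin> F (c m)}" by (auto simp: K_def)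
    have J: "3 * n \<le> card {k \<in> K. (k \<otimes> \<gamma>) \<cdot> m \<notin> V}" if \<gamma>: "\<gamma> \<in> \<Gamma>" for \<gamma>
    proof -
      let ?J = "{k \<in> K. (k \<otimes> \<gamma>) \<cdot> m \<notin> V}"
      let ?Z = "{k \<in> W. (k \<otimes> \<gamma>) \<cdot> m \<in> V}"
      have \<gamma>c: "\<gamma> \<in> carrier G" using \<gamma> \<Gamma>c by auto
      \<comment> \<open>Two such positions place \<open>\<gamma> \<cdot> m\<close> in the
        \<open>Q\<close>-neighbourhoods of the markers \<open>a\<close> and \<open>b\<close>; these
        then coincide, together with the displacements.\<close>
      have "k = k'" if kZ: "k \<in> ?Z" "k' \<in> ?Z" for k k'
      proof -
        obtain a where a: "a \<in> M" "(k \<otimes> \<gamma>) \<cdot> m = k0 a \<cdot> a" using kZ(1) V_iff by blast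
        obtain b where b: "b \<in> M" "(k' \<otimes> \<gamma>) \<cdot> m = k0 b \<cdot> b" using kZ(2) V_iff by blast
        have kc: "k \<in> carrier G" "k' \<in> carrier G" using that Wc by auto
        have ac: "k0 a \<in> carrier G" "k0 b \<in> carrier G" using k0W Wc by auto
        have 1: "\<gamma> \<cdot> m = (inv k \<otimes> k0 a) \<cdot> a"
          using a kc ac \<gamma>c Mx[OF m] Mx[OF a(1)] by (simp add: act_mult act_swap)
        have 2: "\<gamma> \<cdot> m = (inv k' \<otimes> k0 b) \<cdot> b"
          using b kc ac \<gamma>c Mx[OF m] Mx[OF b(1)] by (simp add: act_mult act_swap)
        have "a = b" "inv k \<otimes> k0 a = inv k' \<otimes> k0 b"
          using uniq[OF a(1) b(1) QI QI, of k "k0 a" k' "k0 b"] 1 2 that k0W by auto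
        then show "k = k'" using kc ac by (metis inv_closed inv_inv right_cancel)
      qed
      then have cZ: "card ?Z \<le> 1" using W(1) by (auto intro!: card_le_Suc0_iff_eq[THEN iffD2])
      \<comment> \<open>The only kept point in the window of \<open>m\<close> is its own, at
        position \<open>k0 m\<close>.\<close>
      have "{w \<in> W. w \<cdot> m \<in> U} \<subseteq> ?J \<union> ?Z \<union> {k0 m}"
      proof
        fix w assume w: "w \<in> {w \<in> W. w \<cdot> m \<in> U}"
        show "w \<in> ?J \<union> ?Z \<union> {k0 m}"
        proof (cases "w \<cdot> m \<in> V")
          case True
          then obtain m' where "m' \<in> M" "w \<cdot> m = k0 m' \<cdot> m'" using V_iff by auto
          then have "w = k0 m" using uniqW[OF m, of m' w "k0 m'"] w k0W by auto
          then show ?thesis by simp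
        qed (use w in \<open>auto simp: K_def\<close>)
      qed
      then have "card {w \<in> W. w \<cdot> m \<in> U} \<le> card (?J \<union> ?Z \<union> {k0 m})"
        using W(1) finK by (intro card_mono) auto
      also have "\<dots> \<le> card ?J + card ?Z + card {k0 m}"
        by (intro order.trans[OF card_Un_le] add_mono) auto
      finally show ?thesis using W(4)[OF Mx[OF m]] cZ by simp
    qed
    obtain s where "good (F (c m)) m s"
      using exists_separating_label[OF W(1,2) Mx[OF m] fin(4) \<Gamma>c \<Gamma>1 card\<Gamma> K J]
      by (auto simp: good_def K_def)
    then show ?thesis by (rule sel_good)
  qed

  define P' where "P' = (\<Union>i. F i)"
  have P'_meas: "P' \<in> sets X" unfolding P'_def using F_meas by auto
  have P'_cases: "y \<in> P \<or> (\<exists>m\<in>M. \<exists>w\<in>sel (F (c m)) m. y = w \<cdot> m)" if "y \<in> P'" for y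
    using that F_cases by (fastforce simp: P'_def)
  \<comment> \<open>No other marker fills points in the window of \<open>m\<close>, and
    \<open>m\<close> acts only at stage \<open>c m\<close>, so the values seen there right after
    that stage are final.\<close>
  have fin_near: "k \<cdot> m \<in> P' \<longleftrightarrow> k \<cdot> m \<in> F (c m) \<or> k \<in> sel (F (c m)) m" if m: "m \<in> M" and k: "k \<in> W" for m k
  proof
    assume "k \<cdot> m \<in> P'"
    then consider "k \<cdot> m \<in> P" | m' w where "m' \<in> M" "w \<in> sel (F (c m')) m'" "k \<cdot> m = w \<cdot> m'"
      using P'_cases by blast
    then show "k \<cdot> m \<in> F (c m) \<or> k \<in> sel (F (c m)) m"
    proof cases
      case 1 then show ?thesis using F_mono[of 0 "c m"] F0 by auto
    next
      case 2 then show ?thesis using uniqW[OF m 2(1) k, of w] selW by auto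
    qed
  next
    assume "k \<cdot> m \<in> F (c m) \<or> k \<in> sel (F (c m)) m"
    then show "k \<cdot> m \<in> P'" unfolding P'_def using F_new[OF m lessI] by blast
  qed
  \<comment> \<open>If \<open>\<gamma> \<cdot> m\<close> is close to no other marker, or to one filled earlier, then the choice made at \<open>m\<close> was
    based on the final values at \<open>(k \<otimes> \<gamma>) \<cdot> m\<close>.\<close>
  have fin_far: "(k \<otimes> \<gamma>) \<cdot> m \<in> P' \<longleftrightarrow> (k \<otimes> \<gamma>) \<cdot> m \<in> F (c m) \<or> k \<otimes> \<gamma> \<in> sel (F (c m)) m"
    if m: "m \<in> M" and k: "k \<in> W" and \<gamma>: "\<gamma> \<in> carrier G"
      and early: "\<And>m' q. m' \<in> M \<Longrightarrow> q \<in> Q \<Longrightarrow> \<gamma> \<cdot> m = q \<cdot> m' \<Longrightarrow> m' = m \<or> c m' < c m" for m k \<gamma>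
  proof
    assume "(k \<otimes> \<gamma>) \<cdot> m \<in> P'"
    then consider "(k \<otimes> \<gamma>) \<cdot> m \<in> P" | m' w where "m' \<in> M" "w \<in> sel (F (c m')) m'" "(k \<otimes> \<gamma>) \<cdot> m = w \<cdot> m'"
      using P'_cases by blast
    then show "(k \<otimes> \<gamma>) \<cdot> m \<in> F (c m) \<or> k \<otimes> \<gamma> \<in> sel (F (c m)) m"
    proof cases
      case 1 then show ?thesis using F_mono[of 0 "c m"] F0 by auto
    next
      case 2
      have w: "w \<in> W" using 2 selW by auto
      have "\<gamma> \<cdot> m = (inv k \<otimes> w) \<cdot> m'"
        using 2 k w Wc \<gamma> Mx[OF m] Mx[OF 2(1)] by (simp add: act_mult act_swap)
      then consider "m' = m" | "c m' < c m" using early[OF 2(1) QI[OF k w]] by auto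
      then show ?thesis
      proof cases
        case 1
        then have "k \<otimes> \<gamma> = w" using 2 k w Wc \<gamma> Mx[OF m] by (simp add: act_eq_iff)
        then show ?thesis using 2 1 by auto
      next
        case c: 2 then show ?thesis using F_new[OF 2(1) c 2(2)] 2 by auto
      qed
    qed
  next
    assume "(k \<otimes> \<gamma>) \<cdot> m \<in> F (c m) \<or> k \<otimes> \<gamma> \<in> sel (F (c m)) m"
    then show "(k \<otimes> \<gamma>) \<cdot> m \<in> P'" unfolding P'_def using F_new[OF m lessI] by blast
  qed
  have sep: "\<exists>k\<in>carrier G. k \<cdot> m \<notin> V \<and> k \<cdot> \<gamma> \<cdot> m \<notin> V \<and> (k \<cdot> m \<in> P') \<noteq> (k \<cdot> \<gamma> \<cdot> m \<in> P')"
    if m: "m \<in> M" and \<gamma>: "\<gamma> \<in> \<Gamma>"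
      and early: "\<And>m' q. m' \<in> M \<Longrightarrow> q \<in> Q \<Longrightarrow> \<gamma> \<cdot> m = q \<cdot> m' \<Longrightarrow> m' = m \<or> c m' < c m" for m \<gamma>
  proof -
    obtain k where k: "k \<in> W" "k \<cdot> m \<notin> V" "(k \<otimes> \<gamma>) \<cdot> m \<notin> V"
      "(k \<cdot> m \<in> F (c m) \<or> k \<in> sel (F (c m)) m) \<noteq> ((k \<otimes> \<gamma>) \<cdot> m \<in> F (c m) \<or> k \<otimes> \<gamma> \<in> sel (F (c m)) m)"
      using sel_ok[OF m] \<gamma> unfolding good_def by blast
    have \<gamma>c: "\<gamma> \<in> carrier G" using \<gamma> \<Gamma>c by auto
    have "(k \<otimes> \<gamma>) \<cdot> m \<in> P' \<longleftrightarrow> (k \<otimes> \<gamma>) \<cdot> m \<in> F (c m) \<or> k \<otimes> \<gamma> \<in> sel (F (c m)) m"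
      by (rule fin_far[OF m k(1) \<gamma>c]) (rule early)
    with k(4) fin_near[OF m k(1)] have "(k \<cdot> m \<in> P') \<noteq> ((k \<otimes> \<gamma>) \<cdot> m \<in> P')" by blast
    moreover have "(k \<otimes> \<gamma>) \<cdot> m = k \<cdot> \<gamma> \<cdot> m" using k \<gamma>c Wc Mx[OF m] by (simp add: act_mult)
    ultimately show ?thesis using k Wc by auto
  qed

  \<comment> \<open>Moving \<open>x\<close> to a marker \<open>m\<close> by \<open>d\<close> turns
    \<open>g\<close> into its conjugate \<open>\<gamma>\<close>; if \<open>k\<close> separates
    \<open>m\<close> from \<open>\<gamma> \<cdot> m\<close>, then \<open>k \<otimes> d\<close>
    separates \<open>x\<close> from \<open>g \<cdot> x\<close>.\<close>
  have final: "\<exists>h\<in>carrier G. h \<cdot> x \<notin> V \<and> h \<cdot> g \<cdot> x \<notin> V \<and> (h \<cdot> x \<in> P') \<noteq> (h \<cdot> g \<cdot> x \<in> P')"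
    if x: "x \<in> space X" for x
  proof -
    obtain d where d: "d \<in> D" "d \<cdot> x \<in> M" using M_cov[OF x] by auto
    have dc: "d \<in> carrier G" using d Dc by auto
    define m where "m = d \<cdot> x"
    define \<gamma> where "\<gamma> = d \<otimes> g \<otimes> inv d"
    have m: "m \<in> M" using d by (simp add: m_def)
    have \<gamma>: "\<gamma> \<in> \<Gamma>" unfolding \<gamma>_def using \<Gamma>I d DC by auto
    then have \<gamma>c: "\<gamma> \<in> carrier G" using \<Gamma>c by auto
    have \<gamma>m: "\<gamma> \<cdot> m = d \<cdot> g \<cdot> x" using dc g x by (simp add: \<gamma>_def m_def act_mult)
    show ?thesis
    proof (cases "\<forall>m'\<in>M. \<forall>q\<in>Q. \<gamma> \<cdot> m = q \<cdot> m' \<longrightarrow> m' = m \<or> c m' < c m")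
      case True
      then obtain k where k: "k \<in> carrier G" "k \<cdot> m \<notin> V" "k \<cdot> \<gamma> \<cdot> m \<notin> V" "(k \<cdot> m \<in> P') \<noteq> (k \<cdot> \<gamma> \<cdot> m \<in> P')"
        using sep[OF m \<gamma>] by blast
      then show ?thesis unfolding \<gamma>m unfolding m_def
        using dc g x by (intro bexI[of _ "k \<otimes> d"]) (auto simp: act_mult)
    next
      case False
      \<comment> \<open>Now \<open>\<gamma> \<cdot> m\<close> is close to a marker \<open>m'\<close> filled after \<open>m\<close>, and the separation is read off at \<open>m'\<close>,
        with an inverse conjugate of \<open>g\<close>.\<close>
      then obtain m' q where m': "m' \<in> M" "q \<in> Q" "\<gamma> \<cdot> m = q \<cdot> m'" "m' \<noteq> m" "\<not> c m' < c m" by blast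
      have qc: "q \<in> carrier G" using m' Qc by auto
      have e: "m' = (inv q \<otimes> \<gamma>) \<cdot> m"
        using m' qc \<gamma>c Mx m by (simp add: act_mult)
      have "inv q \<otimes> \<gamma> \<in> E" using Qinv[OF m'(2)] \<gamma> by (auto simp: E_def)
      moreover have "inv q \<otimes> \<gamma> \<noteq> \<one>" using e m'(4) Mx[OF m] by auto
      ultimately have "c m' \<noteq> c m" using c_proper Mx[OF m] e by auto
      then have lt: "c m < c m'" using m'(5) by simp
      define f where "f = inv q \<otimes> d"
      have fc: "f \<in> carrier G" using qc dc by (simp add: f_def)
      \<comment> \<open>The roles are exchanged: \<open>m'\<close> is
        \<open>f \<cdot> g \<cdot> x\<close> and \<open>\<delta> \<cdot> m'\<close> is
        \<open>f \<cdot> x\<close>.\<close>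
      define \<delta> where "\<delta> = f \<otimes> inv g \<otimes> inv f"
      have \<delta>: "\<delta> \<in> \<Gamma>" unfolding \<delta>_def f_def using \<Gamma>I CI Qinv m' d by auto
      have m'f: "m' = f \<cdot> g \<cdot> x"
        unfolding f_def using m'(3) \<gamma>m qc dc g x Mx[OF m'(1)] by (simp add: act_mult)
      have \<delta>m: "\<delta> \<cdot> m' = f \<cdot> x"
        unfolding \<delta>_def m'f using fc g x by (simp add: act_mult)
      have fm: "f \<cdot> x = inv q \<cdot> m" unfolding f_def m_def using qc dc x by (simp add: act_mult)
      \<comment> \<open>Since \<open>\<delta> \<cdot> m'\<close> equals
        \<open>inv q \<cdot> m\<close>, the only marker \<open>Q\<close>-close to it is
        \<open>m\<close>, which is filled before \<open>m'\<close>.\<close>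
      have "m'' = m' \<or> c m'' < c m'" if "m'' \<in> M" "q' \<in> Q" "\<delta> \<cdot> m' = q' \<cdot> m''" for m'' q'
        using uniq(1)[OF m that(1) Qinv[OF m'(2)] that(2)] that(3) \<delta>m fm lt by auto
      then obtain k where k: "k \<in> carrier G" "k \<cdot> m' \<notin> V" "k \<cdot> \<delta> \<cdot> m' \<notin> V" "(k \<cdot> m' \<in> P') \<noteq> (k \<cdot> \<delta> \<cdot> m' \<in> P')"
        using sep[OF m'(1) \<delta>] by blast
      then show ?thesis unfolding \<delta>m unfolding m'f
        using fc g x by (intro bexI[of _ "k \<otimes> f"]) (auto simp: act_mult)
    qed
  qed

  \<comment> \<open>Syndeticity of the kept points: \<open>d\<close> leads to a marker and
    \<open>w\<close> on to the kept point of its window.\<close>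
  define T' where "T' = (\<lambda>(w, d). w \<otimes> d) ` (W \<times> D)"
  have T': "finite T'" "T' \<subseteq> carrier G" using W(1) fin Wc Dc by (auto simp: T'_def subset_iff)
  have cov: "\<exists>t\<in>T'. t \<cdot> x \<in> V" if x: "x \<in> space X" for x
  proof -
    obtain d where d: "d \<in> D" "d \<cdot> x \<in> M" using M_cov[OF x] by auto
    let ?w = "k0 (d \<cdot> x)"
    have "(?w \<otimes> d) \<cdot> x \<in> V" using V_iff d x k0W Wc Dc by (auto simp: act_mult subset_iff)
    moreover have "?w \<otimes> d \<in> T'" using k0W d by (auto simp: T'_def)
    ultimately show ?thesis by blast
  qed
  have VU: "V \<subseteq> U" using V_iff k0U Mx by auto
  have new: "y \<in> P \<or> y \<in> U - V" if "y \<in> P'" for y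
    using P'_cases[OF that] sel_ok by (auto simp: good_def)
  have "P \<subseteq> P'" using F0 by (auto simp: P'_def)
  moreover have "P' \<inter> V = {}" using new VU PU by blast
  moreover have "P' \<subseteq> P \<union> U" using new by blast
  moreover have "\<forall>x\<in>space X. \<exists>t\<in>T'. t \<cdot> x \<in> V" using cov by (rule ballI)
  moreover have "\<forall>x\<in>space X. \<exists>h\<in>carrier G. h \<cdot> x \<notin> V \<and> h \<cdot> g \<cdot> x \<notin> V \<and>
      (h \<cdot> x \<in> P') \<noteq> (h \<cdot> g \<cdot> x \<in> P')"
    using final by (rule ballI)
  ultimately show ?thesis
    using P'_meas V_meas VU T' by (intro exI[of _ P'] exI[of _ V] exI[of _ T'] conjI)
qed

section \<open>Iterating the stages\<close>

lemma exists_separating_set: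
  "\<exists>A\<in>sets X. \<forall>x\<in>space X. \<forall>g\<in>carrier G. g \<noteq> \<one> \<longrightarrow>
    (\<exists>h\<in>carrier G. (h \<cdot> x \<in> A) \<noteq> (h \<cdot> g \<cdot> x \<in> A))"
proof -
  consider "space X = {}" | "finite (carrier G)" | "infinite (carrier G)" "space X \<noteq> {}" by blast
  then show ?thesis
  proof cases
    case 1
    then show ?thesis by (intro bexI[of _ "{}"]) auto
  next
    case 2
    \<comment> \<open>With \<open>D\<close> the whole group, the marker set meets every orbit in
      exactly one point.\<close>
    then obtain M where M: "M \<in> sets X"
      "\<And>x d. x \<in> M \<Longrightarrow> d \<in> carrier G \<Longrightarrow> d \<cdot> x \<in> M \<Longrightarrow> d = \<one>"
      "\<And>x. x \<in> space X \<Longrightarrow> \<exists>d\<in>carrier G. d \<cdot> x \<in> M"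
      using borel_marker_set[of "carrier G"] by auto
    show ?thesis
    proof (intro bexI[OF _ M(1)] ballI impI)
      fix x g assume x: "x \<in> space X" and g: "g \<in> carrier G" "g \<noteq> \<one>"
      obtain h where h: "h \<in> carrier G" "h \<cdot> x \<in> M" using M(3)[OF x] by auto
      have "h \<cdot> g \<cdot> x \<notin> M"
      proof
        assume "h \<cdot> g \<cdot> x \<in> M"
        then have "(h \<otimes> g \<otimes> inv h) \<cdot> h \<cdot> x \<in> M" using h g x by (simp add: act_mult)
        then have "h \<otimes> g \<otimes> inv h = \<one>" using M(2)[OF h(2)] h g by simp
        then have "h \<otimes> g \<otimes> inv h \<otimes> h = h" using h by simp
        then show False using h g by (simp add: m_assoc)
      qed
      then show "\<exists>h\<in>carrier G. (h \<cdot> x \<in> M) \<noteq> (h \<cdot> g \<cdot> x \<in> M)" using h by auto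
    qed
  next
    case 3
    define e where "e = from_nat_into (carrier G - {\<one>})"
    have ne: "carrier G - {\<one>} \<noteq> {}"
      using 3(1) finite_subset[of "carrier G" "{\<one>}"] by auto
    have e: "e i \<in> carrier G" "e i \<noteq> \<one>" for i
      using from_nat_into[OF ne, of i] by (auto simp: e_def)
    define I where "I = (\<lambda>(P, U, T). P \<in> sets X \<and> U \<in> sets X \<and> P \<inter> U = {} \<and>
      finite T \<and> T \<subseteq> carrier G \<and> (\<forall>x\<in>space X. \<exists>t\<in>T. t \<cdot> x \<in> U))"
    define R where "R i = (\<lambda>(P, U, T :: 'g set) (P', U', T' :: 'g set). P \<subseteq> P' \<and> P' \<subseteq> P \<union> U \<and> U' \<subseteq> U \<and>
      (\<forall>x\<in>space X. \<exists>h\<in>carrier G. h \<cdot> x \<notin> U' \<and> h \<cdot> e i \<cdot> x \<notin> U' \<and>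
        (h \<cdot> x \<in> P') \<noteq> (h \<cdot> e i \<cdot> x \<in> P')))" for i
    have "\<exists>f. \<forall>i. I (f i) \<and> R i (f i) (f (Suc i))"
    proof (rule dependent_nat_choice[where P = "\<lambda>_. I"])
      \<comment> \<open>At the start nothing is in \<open>A\<close> and every point is
        undecided.\<close>
      show "\<exists>s. I s" by (rule exI[of _ "({}, space X, {\<one>})"]) (auto simp: I_def)
    next
      fix s i assume s: "I s"
      obtain P U T where PUT: "s = (P, U, T)" by (cases s)
      from s have "P \<in> sets X" "U \<in> sets X" "P \<inter> U = {}" "finite T" "T \<subseteq> carrier G"
        "\<forall>x\<in>space X. \<exists>t\<in>T. t \<cdot> x \<in> U" by (auto simp: I_def PUT)
      from separation_step[OF 3 e[of i] this] obtain P' U' T' where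
        "P' \<in> sets X \<and> U' \<in> sets X \<and> P' \<inter> U' = {} \<and> P \<subseteq> P' \<and> P' \<subseteq> P \<union> U \<and> U' \<subseteq> U \<and>
        finite T' \<and> T' \<subseteq> carrier G \<and> (\<forall>x\<in>space X. \<exists>t\<in>T'. t \<cdot> x \<in> U') \<and>
        (\<forall>x\<in>space X. \<exists>h\<in>carrier G. h \<cdot> x \<notin> U' \<and> h \<cdot> e i \<cdot> x \<notin> U' \<and>
          (h \<cdot> x \<in> P') \<noteq> (h \<cdot> e i \<cdot> x \<in> P'))" by (elim exE) (rule that)
      then show "\<exists>s'. I s' \<and> R i s s'"
        unfolding I_def R_def PUT by (intro exI[of _ "(P', U', T')"]) simp
    qed
    then obtain f where f: "\<And>i. I (f i)" "\<And>i. R i (f i) (f (Suc i))" by blast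
    define P where "P i = fst (f i)" for i
    define U where "U i = fst (snd (f i))" for i
    have P_meas: "P i \<in> sets X" for i using f(1)[of i] by (auto simp: I_def P_def split: prod.splits)
    have step: "P i \<subseteq> P (Suc i)" "P (Suc i) \<subseteq> P i \<union> U i" "U (Suc i) \<subseteq> U i" for i
      using f(2)[of i] by (auto simp: R_def P_def U_def split: prod.splits)
    have sep: "\<exists>h\<in>carrier G. h \<cdot> x \<notin> U (Suc i) \<and> h \<cdot> e i \<cdot> x \<notin> U (Suc i) \<and>
        (h \<cdot> x \<in> P (Suc i)) \<noteq> (h \<cdot> e i \<cdot> x \<in> P (Suc i))" if "x \<in> space X" for x i
      using f(2)[of i] that by (simp add: R_def P_def U_def split: prod.splits)
    have P_mono: "P i \<subseteq> P j" if "i \<le> j" for i j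
      using step(1) that by (rule lift_Suc_mono_le)
    have P_le: "P j \<subseteq> P i \<union> U i \<and> U j \<subseteq> U i" if "i \<le> j" for i j
      using that by (induction j rule: dec_induct) (use step in blast)+
    define A where "A = (\<Union>i. P i)"
    \<comment> \<open>Later stages add only undecided points, so membership is frozen once a point
      has left \<open>U i\<close>.\<close>
    have A: "y \<in> A \<longleftrightarrow> y \<in> P i" if "y \<notin> U i" for y i
    proof
      assume "y \<in> A"
      then obtain j where "y \<in> P j" by (auto simp: A_def)
      then show "y \<in> P i" using P_mono[of j i] P_le[of i j] that by (cases "j \<le> i") auto
    qed (auto simp: A_def)
    show ?thesis
    proof (intro bexI[of _ A] ballI impI)
      fix x g assume x: "x \<in> space X" and g: "g \<in> carrier G" "g \<noteq> \<one>"
      have "countable (carrier G - {\<one>})" using countable_carrier by simp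
      from from_nat_into_surj[OF this, of g] obtain i where i: "g = e i" using g by (auto simp: e_def)
      show "\<exists>h\<in>carrier G. (h \<cdot> x \<in> A) \<noteq> (h \<cdot> g \<cdot> x \<in> A)"
        using sep[OF x, of i] A unfolding i by blast
    qed (use P_meas in \<open>auto simp: A_def\<close>)
  qed
qed

end

subsection \<open>The equivariant map into the shift\<close>

text \<open>Balls with rational radii around a countable dense set: one containing \<open>x\<close>,
  of radius below half the distance from \<open>x\<close> to \<open>F\<close>, misses
  \<open>F\<close>.\<close>

lemma standard_borel_separating_family:
  fixes X :: "'x measure"
  assumes "standard_borel X"
  shows "\<exists>B :: nat \<Rightarrow> 'x set. (\<forall>i. B i \<in> sets X) \<and>
    (\<forall>F x. finite F \<and> x \<in> space X \<and> F \<subseteq> space X \<and> x \<notin> F \<longrightarrow> (\<exists>i. x \<in> B i \<and> B i \<inter> F = {}))"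
proof -
  obtain T where T: "polish_topology T" "space X = topspace T" "sets X = sets (borel_of T)"
    using assms by (auto simp: standard_borel_def)
  obtain M d where Md: "Metric_space M d" and TM: "T = Metric_space.mtopology M d"
    using T(1) by (auto simp: polish_topology_def completely_metrizable_space_def)
  interpret Metric_space M d by (fact Md)
  obtain C where C: "countable C" "C \<subseteq> M" "mtopology closure_of C = M"
    using T(1) by (auto simp: polish_topology_def separable_space_def TM)
  \<comment> \<open>The empty set is inserted so that \<open>from_nat_into\<close> enumerates a
    nonempty family.\<close>
  define \<B> where "\<B> = insert {} ((\<lambda>(c, q). mball c q) ` (C \<times> (\<rat> :: real set)))"
  have c\<B>: "countable \<B>" unfolding \<B>_def using C(1) countable_rat by blast
  show ?thesis
  proof (intro exI[of _ "from_nat_into \<B>"] conjI allI impI)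
    fix i
    have "from_nat_into \<B> i \<in> \<B>" by (rule from_nat_into) (simp add: \<B>_def)
    then show "from_nat_into \<B> i \<in> sets X"
      unfolding T(3) by (auto simp: \<B>_def TM sets_borel_of intro: sigma_sets.Empty sigma_sets.Basic)
  next
    fix F x assume "finite F \<and> x \<in> space X \<and> F \<subseteq> space X \<and> x \<notin> F"
    then have F: "finite F" "F \<subseteq> space X" "x \<notin> F" and x: "x \<in> space X" by auto
    have xM: "x \<in> M" and FM: "F \<subseteq> M" using x F by (auto simp: T(2) TM)
    \<comment> \<open>The inserted \<open>1\<close> makes the minimum meaningful for empty
      \<open>F\<close>.\<close>
    define \<epsilon> where "\<epsilon> = Min (insert 1 (d x ` F))"
    have \<epsilon>: "\<epsilon> > 0" "\<And>y. y \<in> F \<Longrightarrow> \<epsilon> \<le> d x y"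
      using F FM xM by (auto simp: \<epsilon>_def mdist_pos_less)
    have "x \<in> mtopology closure_of C" using xM C by simp
    moreover have "\<epsilon> / 2 > 0" using \<epsilon> by simp
    ultimately obtain c where c: "c \<in> C" "d x c < \<epsilon> / 2"
      unfolding metric_closure_of mem_Collect_eq in_mball by blast
    obtain q :: real where q: "q \<in> \<rat>" "d x c < q" "q < \<epsilon> / 2"
      using Rats_dense_in_real[OF c(2)] by auto
    have "mball c q \<in> \<B>" using c q by (auto simp: \<B>_def)
    then obtain i where i: "from_nat_into \<B> i = mball c q"
      using from_nat_into_surj[OF c\<B>] by metis
    have "x \<in> mball c q" using c q C xM commute[of x c] by auto
    moreover have "y \<notin> mball c q" if "y \<in> F" for y
    proof
      assume "y \<in> mball c q"
      then have "d x y < \<epsilon>" using triangle[of x c y] xM c q C(2) by auto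
      then show False using \<epsilon>(2)[OF that] by simp
    qed
    ultimately show "\<exists>i. x \<in> from_nat_into \<B> i \<and> from_nat_into \<B> i \<inter> F = {}"
      unfolding i[symmetric] by blast
  qed
qed

section \<open>Cylinders and the Borel structure of the shift space\<close>

text \<open>The prescribed values are coded by a set \<open>p\<close> of coordinates; letting
  \<open>p\<close> range over finite sets makes countability of \<open>cylinders\<close>
  immediate.\<close>

definition cylinder :: "('g, 'm) monoid_scheme \<Rightarrow> 'g set \<Rightarrow> 'g set \<Rightarrow> ('g \<Rightarrow> bool) set" where
  "cylinder G F p = {w \<in> topspace (shift_topology G). \<forall>h\<in>F. w h = (h \<in> p)}"

definition cylinders :: "('g, 'm) monoid_scheme \<Rightarrow> ('g \<Rightarrow> bool) set set" where
  "cylinders G = (\<lambda>(F, p). cylinder G F p) `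
     ({F. finite F \<and> F \<subseteq> carrier G} \<times> {p. finite p \<and> p \<subseteq> carrier G})"

lemma topspace_shift_topology: "topspace (shift_topology G) = (\<Pi>\<^sub>E h\<in>carrier G. UNIV)"
  by (simp add: shift_topology_def)

lemma countable_cylinders: "countable (carrier G) \<Longrightarrow> countable (cylinders G)"
  unfolding cylinders_def
  by (intro countable_image countable_SIGMA countable_Collect_finite_subset)

lemma openin_cylinder:
  assumes "V \<in> cylinders G"
  shows "openin (shift_topology G) V"
proof -
  obtain F p where V: "V = cylinder G F p" and F: "finite F" "F \<subseteq> carrier G"
    using assms by (auto simp: cylinders_def)
  define q where "q h = (h \<in> p)" for h
  let ?S = "\<lambda>h. if h \<in> F then {q h} else UNIV"
  have "V = (\<Pi>\<^sub>E h\<in>carrier G. ?S h)"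
    unfolding V cylinder_def topspace_shift_topology q_def[symmetric]
  proof (intro subset_antisym subsetI)
    fix w assume w: "w \<in> {w \<in> \<Pi>\<^sub>E h\<in>carrier G. UNIV. \<forall>h\<in>F. w h = q h}"
    have "w h \<in> ?S h" for h using w by (cases "h \<in> F") simp_all
    then show "w \<in> (\<Pi>\<^sub>E h\<in>carrier G. ?S h)" using w by (simp add: PiE_iff)
  next
    fix w assume w: "w \<in> (\<Pi>\<^sub>E h\<in>carrier G. ?S h)"
    have "w h = q h" if "h \<in> F" for h
      using PiE_mem[OF w, of h] that F(2) by (simp add: subset_iff)
    then show "w \<in> {w \<in> \<Pi>\<^sub>E h\<in>carrier G. UNIV. \<forall>h\<in>F. w h = q h}"
      using w by (simp add: PiE_iff)
  qed
  moreover have "openin (shift_topology G) (\<Pi>\<^sub>E h\<in>carrier G. ?S h)"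
    unfolding shift_topology_def openin_PiE_gen
    using F(1) by (auto intro: finite_subset[of _ F])
  ultimately show ?thesis by simp
qed

lemma cylinder_neighbourhood:
  assumes "openin (shift_topology G) U" "w \<in> U"
  shows "\<exists>V\<in>cylinders G. w \<in> V \<and> V \<subseteq> U"
proof -
  obtain S where S: "finite {h \<in> carrier G. S h \<noteq> UNIV}" "w \<in> (\<Pi>\<^sub>E h\<in>carrier G. S h)"
    "(\<Pi>\<^sub>E h\<in>carrier G. S h) \<subseteq> U"
    using assms unfolding shift_topology_def openin_product_topology_alt by force
  define F where "F = {h \<in> carrier G. S h \<noteq> UNIV}"
  define p where "p = {h \<in> F. w h}"
  have F: "finite F" "F \<subseteq> carrier G" using S(1) by (auto simp: F_def)
  then have "finite p" "p \<subseteq> carrier G" by (auto simp: p_def)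
  with F have "cylinder G F p \<in> cylinders G"
    unfolding cylinders_def by (intro image_eqI[of _ _ "(F, p)"]) auto
  moreover have "w \<in> cylinder G F p"
    using S(2) by (auto simp: cylinder_def topspace_shift_topology PiE_iff p_def)
  moreover have "cylinder G F p \<subseteq> U"
  proof
    fix v assume v: "v \<in> cylinder G F p"
    have "v h \<in> S h" if "h \<in> carrier G" for h
    proof (cases "h \<in> F")
      case True
      then have "v h = w h" using v by (auto simp: cylinder_def p_def)
      then show ?thesis using S(2) that by auto
    qed (use that in \<open>auto simp: F_def\<close>)
    then have "v \<in> (\<Pi>\<^sub>E h\<in>carrier G. S h)"
      using v by (auto simp: cylinder_def topspace_shift_topology PiE_iff)
    then show "v \<in> U" using S(3) by auto
  qed
  ultimately show ?thesis by (intro bexI[of _ "cylinder G F p"] conjI)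
qed

lemma polish_shift_topology:
  assumes "countable (carrier G)"
  shows "polish_topology (shift_topology G)"
proof -
  have "countable {i \<in> carrier G. \<not> (\<exists>a. (UNIV :: bool set) \<subseteq> {a})}"
    using assms by (rule countable_subset[rotated]) auto
  then have "completely_metrizable_space (shift_topology G)"
    by (simp add: shift_topology_def completely_metrizable_space_product_topology
        completely_metrizable_space_discrete_topology)
  moreover have "second_countable (shift_topology G)"
    unfolding second_countable_def
  proof (intro exI conjI ballI allI impI)
    show "countable (cylinders G)" by (rule countable_cylinders[OF assms])
    show "openin (shift_topology G) V" if "V \<in> cylinders G" for V
      using that by (rule openin_cylinder)
    show "\<exists>V\<in>cylinders G. w \<in> V \<and> V \<subseteq> U" if "openin (shift_topology G) U \<and> w \<in> U" for U w
      using that cylinder_neighbourhood by blast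
  qed
  ultimately show ?thesis
    by (simp add: polish_topology_def second_countable_imp_separable_space)
qed

text \<open>Every open set is a countable union of cylinders, and the preimage of a cylinder is a
  finite condition on coordinates.\<close>

lemma measurable_borel_of_shift_topology:
  assumes "countable (carrier G)"
    and f: "f \<in> space X \<rightarrow> topspace (shift_topology G)"
    and coord: "\<And>h. h \<in> carrier G \<Longrightarrow> Measurable.pred X (\<lambda>x. f x h)"
  shows "f \<in> measurable X (borel_of (shift_topology G))"
  unfolding borel_of_def
proof (rule measurable_measure_of)
  show "{U. openin (shift_topology G) U} \<subseteq> Pow (topspace (shift_topology G))"
    by (auto dest: openin_subset)
  fix U assume "U \<in> {U. openin (shift_topology G) U}"
  then have U: "openin (shift_topology G) U" by simp
  have "U = \<Union>{V \<in> cylinders G. V \<subseteq> U}" using cylinder_neighbourhood[OF U] by blast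
  then have eq: "f -` U \<inter> space X = (\<Union>V\<in>{V \<in> cylinders G. V \<subseteq> U}. f -` V \<inter> space X)" by blast
  moreover have "f -` V \<inter> space X \<in> sets X" if V_cyl: "V \<in> cylinders G" for V
  proof -
    obtain F p where V: "V = cylinder G F p" and F: "finite F" "F \<subseteq> carrier G"
      using V_cyl by (auto simp: cylinders_def)
    have "f -` V \<inter> space X = {x \<in> space X. \<forall>h\<in>F. f x h = (h \<in> p)}"
      using f by (auto simp: V cylinder_def)
    also have "\<dots> \<in> sets X"
    proof -
      have [measurable]: "Measurable.pred X (\<lambda>x. f x h)" if "h \<in> F" for h
        using coord that F by auto
      show ?thesis using F(1) by measurable
    qed
    finally show ?thesis .
  qed
  moreover have "countable {V \<in> cylinders G. V \<subseteq> U}"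
    using countable_cylinders[OF assms(1)] by (rule countable_subset[rotated]) auto
  ultimately show "f -` U \<inter> space X \<in> sets X"
    unfolding eq by (intro sets.countable_UN'') auto
qed (fact f)

section \<open>The shift action and equivariant maps into its free part\<close>

lemma (in group) shift_shift:
  assumes "g \<in> carrier G" "h \<in> carrier G"
  shows "shift G g (shift G h w) = shift G (g \<otimes> h) w"
  using assms by (auto simp: shift_def restrict_def inv_mult_group m_assoc)

text \<open>Stabilizers along an orbit are conjugate: if \<open>g\<close> fixes
  \<open>shift G s w\<close>, then \<open>inv s \<otimes> (g \<otimes> s)\<close> fixes
  \<open>w\<close>.\<close>

lemma (in group) shift_free_part:
  assumes s: "s \<in> carrier G" and w: "w \<in> free_part G"
  shows "shift G s w \<in> free_part G"
  unfolding free_part_def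
proof (intro CollectI conjI ballI impI notI)
  show "shift G s w \<in> topspace (shift_topology G)"
    by (auto simp: shift_def topspace_shift_topology)
  fix g assume g: "g \<in> carrier G" "g \<noteq> \<one>" and eq: "shift G g (shift G s w) = shift G s w"
  have w1: "shift G \<one> w = w"
    using w by (auto simp: shift_def free_part_def topspace_shift_topology PiE_iff extensional_def restrict_def)
  have "shift G (inv s) (shift G g (shift G s w)) = w"
    unfolding eq using s w1 by (simp add: shift_shift)
  then have "shift G (inv s \<otimes> (g \<otimes> s)) w = w" using s g by (simp add: shift_shift)
  then have "inv s \<otimes> (g \<otimes> s) = \<one>" using w s g by (auto simp: free_part_def)
  then have "s \<otimes> (inv s \<otimes> (g \<otimes> s)) = s" using s by simp
  then have "g \<otimes> s = s" using s g by (simp flip: m_assoc)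
  then show False using s g by simp
qed

lemma action_graph_subset:
  assumes "group G" "S \<subseteq> carrier G" "\<And>s x. s \<in> carrier G \<Longrightarrow> x \<in> Y \<Longrightarrow> act s x \<in> Y"
  shows "action_graph G S Y act \<subseteq> Y \<times> Y"
proof -
  interpret group G by fact
  show ?thesis using assms(2,3) by (auto simp: action_graph_def)
qed

lemma exists_equivariant_borel_map:
  fixes G :: "('g, 'm) monoid_scheme" (structure) and X :: "'x measure" and a :: "'g \<Rightarrow> 'x \<Rightarrow> 'x"
  assumes "group G" "countable (carrier G)" "standard_borel X" "borel_action G X a"
    and "free_action G (space X) a"
  obtains \<Phi> where "\<Phi> \<in> measurable X (free_shift G)"
    "\<And>g x. g \<in> carrier G \<Longrightarrow> x \<in> space X \<Longrightarrow> \<Phi> (a g x) = shift G g (\<Phi> x)"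
proof -
  from standard_borel_separating_family[OF assms(3)] obtain B :: "nat \<Rightarrow> 'x set"
    where B: "\<forall>i. B i \<in> sets X"
      "\<forall>F x. finite F \<and> x \<in> space X \<and> F \<subseteq> space X \<and> x \<notin> F \<longrightarrow> (\<exists>i. x \<in> B i \<and> B i \<inter> F = {})"
    by (elim exE conjE) (rule that)
  interpret action: group_action G "space X" a
    using assms(4) by (simp add: borel_action_def)
  interpret group G by fact
  have meas: "(\<lambda>(g, x). a g x) \<in> measurable (count_space (carrier G) \<Otimes>\<^sub>M X) X"
    using assms(4) by (simp add: borel_action_def)
  interpret free_borel_action G X a B
  proof
    fix g assume g: "g \<in> carrier G"
    then have "Pair g \<in> measurable X (count_space (carrier G) \<Otimes>\<^sub>M X)" by simp
    from measurable_compose[OF this meas] show "a g \<in> measurable X X" by simp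
  next
    fix x assume "x \<in> space X"
    then show "a \<one> x = x" using action.id_eq_one by (metis restrict_apply')
  next
    fix g h x assume "g \<in> carrier G" "h \<in> carrier G" "x \<in> space X"
    then show "a (g \<otimes> h) x = a g (a h x)" by (simp add: action.composition_rule)
  qed (use assms(2,5) B in \<open>auto simp: free_action_def\<close>)
  obtain A where A: "A \<in> sets X" "\<And>x g. x \<in> space X \<Longrightarrow> g \<in> carrier G \<Longrightarrow> g \<noteq> \<one> \<Longrightarrow>
      \<exists>h\<in>carrier G. (a h x \<in> A) \<noteq> (a h (a g x) \<in> A)"
    using exists_separating_set by blast
  \<comment> \<open>The inverse on \<open>h\<close> makes the map equivariant for the left shift;
    evaluating at \<open>inv h\<close> later recovers the test \<open>a h x \<in> A\<close>.\<close>
  define \<Phi> where "\<Phi> x = (\<lambda>h\<in>carrier G. a (inv h) x \<in> A)" for x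
  have equiv: "\<Phi> (a g x) = shift G g (\<Phi> x)" if "g \<in> carrier G" "x \<in> space X" for g x
    using that by (auto simp: \<Phi>_def shift_def restrict_def inv_mult_group act_mult)
  have top: "\<Phi> x \<in> topspace (shift_topology G)" for x
    by (auto simp: \<Phi>_def topspace_shift_topology)
  have "\<Phi> x \<in> free_part G" if x: "x \<in> space X" for x
    unfolding free_part_def
  proof (intro CollectI conjI ballI impI notI top)
    fix g assume g: "g \<in> carrier G" "g \<noteq> \<one>" and "shift G g (\<Phi> x) = \<Phi> x"
    then have eq: "\<Phi> (a g x) = \<Phi> x" using equiv x by simp
    obtain h where h: "h \<in> carrier G" "(a h x \<in> A) \<noteq> (a h (a g x) \<in> A)" using A(2)[OF x g] by blast
    then show False using fun_cong[OF eq, of "inv h"] by (simp add: \<Phi>_def)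
  qed
  moreover have "\<Phi> \<in> measurable X (borel_of (shift_topology G))"
  proof (rule measurable_borel_of_shift_topology[OF assms(2)])
    fix h assume h: "h \<in> carrier G"
    have "Measurable.pred X (\<lambda>x. a (inv h) x \<in> A)" using h A(1) by (intro sets_act) auto
    then show "Measurable.pred X (\<lambda>x. \<Phi> x h)" using h by (simp add: \<Phi>_def)
  qed (use top in auto)
  ultimately have "\<Phi> \<in> measurable X (free_shift G)"
    unfolding free_shift_def by (intro measurable_restrict_space2) auto
  then show thesis using equiv that by blast
qed

section \<open>Comparison of the chromatic numbers\<close>

theorem corollary2p5:
  fixes G :: "('g, 'm) monoid_scheme"
    and S :: "'g set"
    and X :: "'x measure"
    and a :: "'g \<Rightarrow> 'x \<Rightarrow> 'x"
  assumes "group G"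
    and "countable (carrier G)"
    and "S \<subseteq> carrier G"
    and "standard_borel X"
    and "borel_action G X a"
    and "free_action G (space X) a"
  shows "borel_chromatic_number X (action_graph G S (space X) a)
           \<le>o borel_chromatic_number (free_shift G) (action_graph G S (free_part G) (shift G))"
proof -
  let ?E = "action_graph G S (space X) a" and ?E' = "action_graph G S (free_part G) (shift G)"
  interpret group G by fact
  interpret action: group_action G "space X" a
    using assms(5) by (simp add: borel_action_def)
  have S: "s \<in> carrier G" if "s \<in> S \<union> (\<lambda>s. inv\<^bsub>G\<^esub> s) ` S" for s using that assms(3) by auto
  have sub: "?E \<subseteq> space X \<times> space X"
    using action.element_image by (intro action_graph_subset assms) auto
  have sp: "space (free_shift G) = free_part G"
    by (auto simp: free_shift_def space_restrict_space free_part_def)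
  have sub': "?E' \<subseteq> space (free_shift G) \<times> space (free_shift G)"
    unfolding sp by (intro action_graph_subset assms shift_free_part)
  \<comment> \<open>The inclusion into the whole shift space, which is Polish, is one Borel coloring
    of the free part, so the minimum defining its chromatic number is attained.\<close>
  have "borel_coloring (free_shift G) ?E' (borel_of (shift_topology G)) (\<lambda>w. w)"
    unfolding borel_coloring_def
  proof
    show "(\<lambda>w. w) \<in> measurable (free_shift G) (borel_of (shift_topology G))"
      unfolding free_shift_def by (intro measurable_restrict_space1) simp
    have "w \<noteq> shift G s w" if "w \<in> free_part G" "s \<in> carrier G" "s \<noteq> \<one>\<^bsub>G\<^esub>" for w s
      using that unfolding free_part_def by force
    then show "\<forall>(w, w')\<in>?E'. w \<noteq> w'" using S unfolding action_graph_def by blast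
  qed
  then have "borel_colorable (free_shift G) ?E' (borel_of (shift_topology G))"
    using polish_shift_topology[OF assms(2)] by (auto simp: borel_colorable_def standard_borel_def)
  then obtain K :: "real measure" where K: "borel_colorable (free_shift G) ?E' K"
    "borel_chromatic_number (free_shift G) ?E' = |space K|"
    using borel_chromatic_number_min[OF _ sub'] by blast
  then obtain \<kappa> where \<kappa>: "borel_coloring (free_shift G) ?E' K \<kappa>"
    by (auto simp: borel_colorable_def)
  obtain \<Phi> where \<Phi>: "\<Phi> \<in> measurable X (free_shift G)"
    "\<And>g x. g \<in> carrier G \<Longrightarrow> x \<in> space X \<Longrightarrow> \<Phi> (a g x) = shift G g (\<Phi> x)"
    by (rule exists_equivariant_borel_map[OF assms(1,2,4-6)]) (rule that)
  \<comment> \<open>Equivariance makes the map a graph homomorphism, so an optimal coloring pulls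
    back with the same color space.\<close>
  have "(\<Phi> x, \<Phi> y) \<in> ?E'" if "(x, y) \<in> ?E" for x y
  proof -
    obtain s where s: "x \<in> space X" "y = a s x" "s \<in> S \<union> (\<lambda>s. inv\<^bsub>G\<^esub> s) ` S" "s \<noteq> \<one>\<^bsub>G\<^esub>"
      using \<open>(x, y) \<in> ?E\<close> by (auto simp: action_graph_def)
    moreover have "\<Phi> x \<in> free_part G" using measurable_space[OF \<Phi>(1) s(1)] sp by simp
    ultimately show ?thesis using \<Phi>(2) S unfolding action_graph_def by blast
  qed
  then have "borel_coloring X ?E K (\<lambda>x. \<kappa> (\<Phi> x))"
    using \<kappa> measurable_compose[OF \<Phi>(1)] unfolding borel_coloring_def by blast
  then have "borel_colorable X ?E K"
    using K(1) by (auto simp: borel_colorable_def)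
  from borel_chromatic_number_le[OF this sub] show ?thesis by (simp add: K(2))
qed

end
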